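(* Let $\varphi$ be an $H$-flow on $M$ such that $h_{\mathrm{Gur}}(\varphi)>0$. Let $K_0\subset M$ be a compact set with nonempty interior. Let $A\subset M$ be a Borel set and $0<\alpha'<\alpha$. There exists $N>0$ such that for all $L>T_0>5\tau_{K_0}$ with $\frac L{T_0}\ge N$ and $m_{K_0,L}(A)\ge\alpha$, we have $$\#\left\{\gamma\in\mathcal P'_{K_0}(L,L+5\tau_{K_0}):\ \exists s\in[0,T_0],\ \#\Big\{i\in\{0,\dots,\lfloor L/T_0\rfloor-1\}:\gamma(s+iT_0)\in A\Big\}\ge\frac{\alpha'}2\frac L{T_0}\right\}\ \ge\ 0.99\times\frac{\alpha-\alpha'}{1-\alpha'}\times\#\mathcal P_{K_0}(L,L+5\tau_{K_0}).$$
   Context: **Setting.** $(M,g)$ is a complete connected (not necessarily compact) Riemannian manifold with associated distance $d$; $B(x,r)$ is the open ball. **$H$-flow.** An $H$-flow is a $C^1$ flow $(\varphi_t)_{t\in\mathbb R}$ on a complete Riemannian manifold such that: (1) there is a constant $lip(\varphi)$ with $d(\varphi_\tau(x),\varphi_\tau(y))\le lip(\varphi)\,d(x,y)$ for all $x,y\in M$, $\tau\in[-1,1]$; (2) there exist $0<a\le b$ such that for every $x\in M$ there is $\rho>0$ with $a|t|\le d(x,\varphi_t(x))\le b|t|$ for all $t\in[-\rho,\rho]$; (3) (transitivity) for all nonempty open $U,V\subset M$ and every $T>0$ there is $t\ge T$ with $\varphi_t(U)\cap V\ne\emptyset$; (4) (finite exact shadowing) for every compact $K\subset M$, $\delta>0$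 and integer $N\ge1$ there is $\eta>0$ such that, for all $x_1,\dots,x_N\in K$ and $t_1,\dots,t_N\ge 0$ with $d(\varphi_{t_i}(x_i),x_{i+1})<\eta$ for $1\le i\le N-1$, there is $y\in M$ with $d(\varphi_{s+\sum_{j=1}^{i-1}t_j}(y),\varphi_s(x_i))<\delta$ for all $1\le i\le N$ and $0\le s\le t_i$; (5) (closing lemma) for every $\epsilon>0$ and $x\in M$ there exist $\delta>0$ and $T_{\min}>0$ such that for every $y\in B(x,\epsilon)$ and $t\ge T_{\min}$ with $d(\varphi_t(y),y)\le\delta$ there exist $z\in B(y,\epsilon)$ and $\tau\in[t-\epsilon,t+\epsilon]$ with $\varphi_\tau(z)=z$ and $d(\varphi_s(z),\varphi_s(y))\le\epsilon$ for all $0\le s\le t$; (6) (expansivity) for every $\nu>0$ there is $\epsilon>0$ such that, for all $x,y\in M$, if there is a continuous map $s:\mathbb R\to\mathbb R$ with $s(0)=0$ and $d(\varphi_t(x),\varphi_{s(t)}(y))\le\epsilon$ for all $t\in\mathbb R$, then $y=\varphi_\tau(x)$ for some $\tau\in[-\nu,\nu]$. **Periodic orbits.** A periodic orbit $\gamma$ is a pair $(\{\varphi_t(x):t\in\mathbb R\},T)$ with $T>0$, $\varphi_T(x)=x$; its period is $\ell(\gamma)=T$ (so multiples of an orbit count as distinct periodic orbits). Each periodic orbit is given a parametrization $\gamma:\mathbb R\to M$, $\gamma(s)=\varphi_s(\gamma(0))$ (the origin $\gamma(0)$ is an arbitrary fixed point of the orbit). For $K$ compact, $\mathcal P_K(T_0,T_1)$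 is the set of periodic orbits $\gamma$ with $\ell(\gamma)\in[T_0,T_1]$ and $\gamma\cap K\neq\emptyset$; $\mathcal P'_K(T_0,T_1)\subset\mathcal P_K(T_0,T_1)$ is the subset of primitive ones, i.e. those $(\{\varphi_t(x)\},T)$ with $\varphi_t(x)\ne x$ for all $t\in(0,T)$. $\tau_K$ is the minimal period of a periodic orbit (possibly multiply covered) with period $\ge1$ intersecting $K$. $h_{\mathrm{Gur}}(\varphi)=\limsup_{L\to\infty}\frac1L\log\#\mathcal P_K(L,L+\sigma)$ for any compact $K$ with nonempty interior and any $\sigma>0$ (independent of $K,\sigma$). **Measures.** $\mu_\gamma$ is the invariant probability measure equidistributed (with respect to time) on $\gamma$, and $m_{K_0,L}=\frac{1}{\#\mathcal P_{K_0}(L,L+5\tau_{K_0})}\sum_{\gamma\in\mathcal P_{K_0}(L,L+5\tau_{K_0})}\mu_\gamma$. *)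

theory Defs
  imports "HOL-Analysis.Analysis"
begin

section \<open>Riemannian manifolds\<close>

text \<open>The manifold is carried by a type of class \<open>metric_space\<close>, whose \<open>dist\<close> is required
  to be the Riemannian distance. The Riemannian structure is given by an atlas of smooth charts with
  values in a Euclidean space, each chart carrying the coordinate expression of the metric tensor.\<close>

text \<open>Intended for open \<open>S\<close> only. In finite dimension, continuity of \<open>x \<mapsto> Df x v\<close> for every
  fixed \<open>v\<close> amounts to continuity of \<open>Df\<close>.\<close>

primrec Ck_on :: "nat \<Rightarrow> ('e::real_normed_vector \<Rightarrow> 'f::real_normed_vector) \<Rightarrow> 'e set \<Rightarrow> bool" where
  "Ck_on 0 f S \<longleftrightarrow> continuous_on S f"
| "Ck_on (Suc k) f S \<longleftrightarrow>
     (\<forall>x\<in>S. f differentiable (at x)) \<and> (\<forall>v. Ck_on k (\<lambda>x. frechet_derivative f (at x) v) S)"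

definition smooth_on :: "('e::real_normed_vector \<Rightarrow> 'f::real_normed_vector) \<Rightarrow> 'e set \<Rightarrow> bool" where
  "smooth_on f S \<longleftrightarrow> (\<forall>k. Ck_on k f S)"

text \<open>\<open>cmet c y u v\<close> is the metric tensor at the point with coordinates \<open>y\<close>, applied to the
  tangent vectors with coordinates \<open>u\<close> and \<open>v\<close>.\<close>

record ('a, 'e) rchart =
  cdom :: "'a set"
  cmap :: "'a \<Rightarrow> 'e"
  cmet :: "'e \<Rightarrow> 'e \<Rightarrow> 'e \<Rightarrow> real"

definition cinv :: "('a, 'e) rchart \<Rightarrow> 'e \<Rightarrow> 'a" where
  "cinv c = inv_into (cdom c) (cmap c)"

definition transition :: "('a, 'e) rchart \<Rightarrow> ('a, 'e) rchart \<Rightarrow> 'e \<Rightarrow> 'e" where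
  "transition c c' = cmap c' \<circ> cinv c"

definition inner_product :: "('e::real_vector \<Rightarrow> 'e \<Rightarrow> real) \<Rightarrow> bool" where
  "inner_product g \<longleftrightarrow>
     (\<forall>v. linear (\<lambda>u. g u v)) \<and> (\<forall>u v. g u v = g v u) \<and> (\<forall>u. u \<noteq> 0 \<longrightarrow> g u u > 0)"

definition riemannian_atlas :: "('a::metric_space, 'e::euclidean_space) rchart set \<Rightarrow> bool" where
  "riemannian_atlas \<A> \<longleftrightarrow>
     (\<Union>c\<in>\<A>. cdom c) = UNIV \<and>
     (\<forall>c\<in>\<A>. open (cdom c) \<and> open (cmap c ` cdom c) \<and>
        homeomorphism (cdom c) (cmap c ` cdom c) (cmap c) (cinv c)) \<and>
     (\<forall>c\<in>\<A>. \<forall>c'\<in>\<A>. smooth_on (transition c c') (cmap c ` (cdom c \<inter> cdom c'))) \<and>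
     (\<forall>c\<in>\<A>. \<forall>y\<in>cmap c ` cdom c. inner_product (cmet c y)) \<and>
     (\<forall>c\<in>\<A>. \<forall>u v. smooth_on (\<lambda>y. cmet c y u v) (cmap c ` cdom c)) \<and>
     (\<forall>c\<in>\<A>. \<forall>c'\<in>\<A>. \<forall>y\<in>cmap c ` (cdom c \<inter> cdom c'). \<forall>u v.
        cmet c y u v =
        cmet c' (transition c c' y) (frechet_derivative (transition c c') (at y) u)
                                    (frechet_derivative (transition c c') (at y) v))"

definition piecewise_C1_curve :: "('a::metric_space, 'e::euclidean_space) rchart set \<Rightarrow> (real \<Rightarrow> 'a) \<Rightarrow> bool" where
  "piecewise_C1_curve \<A> p \<longleftrightarrow>
     continuous_on {0..1} p \<and>
     (\<exists>S. finite S \<and> (\<forall>t\<in>{0<..<1} - S. \<forall>c\<in>\<A>. p t \<in> cdom c \<longrightarrow>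
        (\<exists>e>0. (cmap c \<circ> p) C1_differentiable_on {t - e<..<t + e})))"

text \<open>By the transformation law of the metric tensor, the choice of the chart is irrelevant at the
  points where the curve is differentiable.\<close>

definition curve_speed :: "('a::metric_space, 'e::euclidean_space) rchart set \<Rightarrow> (real \<Rightarrow> 'a) \<Rightarrow> real \<Rightarrow> real" where
  "curve_speed \<A> p t =
     (let c = (SOME c. c \<in> \<A> \<and> p t \<in> cdom c);
          v = vector_derivative (cmap c \<circ> p) (at t)
      in sqrt (cmet c (cmap c (p t)) v v))"

text \<open>As in the library notion \<open>piecewise_C1_differentiable_on\<close>, the derivative of a piecewise C1
  curve may blow up at the break points. The length is therefore taken in \<open>ennreal\<close>: curves of
  infinite length do not affect the infimum below.\<close>

definition curve_length :: "('a::metric_space, 'e::euclidean_space) rchart set \<Rightarrow> (real \<Rightarrow> 'a) \<Rightarrow> ennreal" where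
  "curve_length \<A> p = (\<integral>\<^sup>+ t \<in> {0..1}. ennreal (curve_speed \<A> p t) \<partial>lborel)"

definition riemannian_dist :: "('a::metric_space, 'e::euclidean_space) rchart set \<Rightarrow> 'a \<Rightarrow> 'a \<Rightarrow> ennreal" where
  "riemannian_dist \<A> x y =
     (INF p \<in> {p. piecewise_C1_curve \<A> p \<and> p 0 = x \<and> p 1 = y}. curve_length \<A> p)"

locale complete_riemannian_manifold =
  fixes \<A> :: "('a::metric_space, 'e::euclidean_space) rchart set"
  assumes atlas: "riemannian_atlas \<A>"
    and connected: "connected (UNIV :: 'a set)"
    and dist_eq: "\<And>x y. ennreal (dist x y) = riemannian_dist \<A> x y"
    and complete: "complete (UNIV :: 'a set)"

section \<open>H-flows\<close>

definition is_flow :: "(real \<Rightarrow> 'a \<Rightarrow> 'a) \<Rightarrow> bool" where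
  "is_flow \<phi> \<longleftrightarrow> (\<forall>x. \<phi> 0 x = x) \<and> (\<forall>s t x. \<phi> (s + t) x = \<phi> s (\<phi> t x))"

definition C1_flow :: "('a::metric_space, 'e::euclidean_space) rchart set \<Rightarrow> (real \<Rightarrow> 'a \<Rightarrow> 'a) \<Rightarrow> bool" where
  "C1_flow \<A> \<phi> \<longleftrightarrow>
     is_flow \<phi> \<and>
     continuous_on UNIV (\<lambda>(t, x). \<phi> t x) \<and>
     (\<forall>c\<in>\<A>. \<forall>c'\<in>\<A>.
        Ck_on 1 (\<lambda>(t, y). cmap c' (\<phi> t (cinv c y)))
          {(t, y). y \<in> cmap c ` cdom c \<and> \<phi> t (cinv c y) \<in> cdom c'})"

locale H_flow = complete_riemannian_manifold \<A>
  for \<A> :: "('a::metric_space, 'e::euclidean_space) rchart set" +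
  fixes \<phi> :: "real \<Rightarrow> 'a \<Rightarrow> 'a"
  assumes C1: "C1_flow \<A> \<phi>"
    and lipschitz:
      "\<exists>lip. \<forall>x y. \<forall>\<tau>\<in>{-1..1}. dist (\<phi> \<tau> x) (\<phi> \<tau> y) \<le> lip * dist x y"
    and speed:
      "\<exists>a b. 0 < a \<and> a \<le> b \<and>
         (\<forall>x. \<exists>\<rho>>0. \<forall>t\<in>{-\<rho>..\<rho>}. a * \<bar>t\<bar> \<le> dist x (\<phi> t x) \<and> dist x (\<phi> t x) \<le> b * \<bar>t\<bar>)"
    and transitivity:
      "\<And>U V T. open U \<Longrightarrow> U \<noteq> {} \<Longrightarrow> open V \<Longrightarrow> V \<noteq> {} \<Longrightarrow> T > 0 \<Longrightarrow> \<exists>t\<ge>T. \<phi> t ` U \<inter> V \<noteq> {}"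
    and finite_exact_shadowing:
      "\<And>K \<delta> N. compact K \<Longrightarrow> \<delta> > 0 \<Longrightarrow> N \<ge> (1::nat) \<Longrightarrow>
         \<exists>\<eta>>0. \<forall>(x :: nat \<Rightarrow> 'a) (t :: nat \<Rightarrow> real).
           (\<forall>i\<in>{1..N}. x i \<in> K \<and> t i \<ge> 0) \<and>
           (\<forall>i\<in>{1..<N}. dist (\<phi> (t i) (x i)) (x (i + 1)) < \<eta>) \<longrightarrow>
           (\<exists>y. \<forall>i\<in>{1..N}. \<forall>s\<in>{0..t i}. dist (\<phi> (s + (\<Sum>j\<in>{1..<i}. t j)) y) (\<phi> s (x i)) < \<delta>)"
    and closing_lemma:
      "\<And>\<epsilon> x. \<epsilon> > 0 \<Longrightarrow>
         \<exists>\<delta>>0. \<exists>Tmin>0. \<forall>y\<in>ball x \<epsilon>. \<forall>t\<ge>Tmin. dist (\<phi> t y) y \<le> \<delta> \<longrightarrow>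
           (\<exists>z\<in>ball y \<epsilon>. \<exists>\<tau>\<in>{t - \<epsilon>..t + \<epsilon>}. \<phi> \<tau> z = z \<and>
              (\<forall>s\<in>{0..t}. dist (\<phi> s z) (\<phi> s y) \<le> \<epsilon>))"
    and expansivity:
      "\<And>\<nu>. \<nu> > 0 \<Longrightarrow>
         \<exists>\<epsilon>>0. \<forall>x y.
           (\<exists>s :: real \<Rightarrow> real. continuous_on UNIV s \<and> s 0 = 0 \<and>
              (\<forall>t. dist (\<phi> t x) (\<phi> (s t) y) \<le> \<epsilon>)) \<longrightarrow>
           (\<exists>\<tau>\<in>{-\<nu>..\<nu>}. y = \<phi> \<tau> x)"

section \<open>Periodic orbits\<close>

definition flow_orbit :: "(real \<Rightarrow> 'a \<Rightarrow> 'a) \<Rightarrow> 'a \<Rightarrow> 'a set" where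
  "flow_orbit \<phi> x = range (\<lambda>t. \<phi> t x)"

definition periodic_orbits :: "(real \<Rightarrow> 'a \<Rightarrow> 'a) \<Rightarrow> ('a set \<times> real) set" where
  "periodic_orbits \<phi> = {(flow_orbit \<phi> x, T) | x T. T > 0 \<and> \<phi> T x = x}"

definition primitive_orbits :: "(real \<Rightarrow> 'a \<Rightarrow> 'a) \<Rightarrow> ('a set \<times> real) set" where
  "primitive_orbits \<phi> =
     {(flow_orbit \<phi> x, T) | x T. T > 0 \<and> \<phi> T x = x \<and> (\<forall>t\<in>{0<..<T}. \<phi> t x \<noteq> x)}"

abbreviation period :: "'a set \<times> real \<Rightarrow> real" where
  "period \<equiv> snd"

definition PK :: "(real \<Rightarrow> 'a \<Rightarrow> 'a) \<Rightarrow> 'a set \<Rightarrow> real \<Rightarrow> real \<Rightarrow> ('a set \<times> real) set" where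
  "PK \<phi> K T0 T1 = {\<gamma> \<in> periodic_orbits \<phi>. period \<gamma> \<in> {T0..T1} \<and> fst \<gamma> \<inter> K \<noteq> {}}"

definition PK_prim :: "(real \<Rightarrow> 'a \<Rightarrow> 'a) \<Rightarrow> 'a set \<Rightarrow> real \<Rightarrow> real \<Rightarrow> ('a set \<times> real) set" where
  "PK_prim \<phi> K T0 T1 = PK \<phi> K T0 T1 \<inter> primitive_orbits \<phi>"

definition tauK :: "(real \<Rightarrow> 'a \<Rightarrow> 'a) \<Rightarrow> 'a set \<Rightarrow> real" where
  "tauK \<phi> K = (LEAST T. \<exists>\<gamma>\<in>periodic_orbits \<phi>. period \<gamma> = T \<and> T \<ge> 1 \<and> fst \<gamma> \<inter> K \<noteq> {})"

definition log_card :: "'b set \<Rightarrow> ereal" where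
  "log_card S = (if infinite S then \<infinity> else if S = {} then -\<infinity> else ereal (ln (real (card S))))"

text \<open>For an H-flow the value does not depend on the compact set \<open>K\<close> with nonempty interior, nor on
  \<open>\<sigma> > 0\<close>; both are kept as parameters rather than being fixed by an arbitrary choice.\<close>

definition h_Gur :: "(real \<Rightarrow> 'a \<Rightarrow> 'a) \<Rightarrow> 'a set \<Rightarrow> real \<Rightarrow> ereal" where
  "h_Gur \<phi> K \<sigma> = Limsup at_top (\<lambda>L. log_card (PK \<phi> K L (L + \<sigma>)) / ereal L)"

section \<open>Parametrizations and orbit measures\<close>

definition origin_choice :: "(real \<Rightarrow> 'a \<Rightarrow> 'a) \<Rightarrow> ('a set \<times> real \<Rightarrow> 'a) \<Rightarrow> bool" where
  "origin_choice \<phi> orig \<longleftrightarrow> (\<forall>\<gamma>\<in>periodic_orbits \<phi>. orig \<gamma> \<in> fst \<gamma>)"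

definition param :: "(real \<Rightarrow> 'a \<Rightarrow> 'a) \<Rightarrow> ('a set \<times> real \<Rightarrow> 'a) \<Rightarrow> 'a set \<times> real \<Rightarrow> real \<Rightarrow> 'a" where
  "param \<phi> orig \<gamma> s = \<phi> s (orig \<gamma>)"

definition orbit_measure ::
  "(real \<Rightarrow> 'a::metric_space \<Rightarrow> 'a) \<Rightarrow> ('a set \<times> real \<Rightarrow> 'a) \<Rightarrow> 'a set \<times> real \<Rightarrow> 'a measure" where
  "orbit_measure \<phi> orig \<gamma> =
     distr (uniform_measure lborel {0..period \<gamma>}) borel (param \<phi> orig \<gamma>)"

definition mKL ::
  "(real \<Rightarrow> 'a::metric_space \<Rightarrow> 'a) \<Rightarrow> ('a set \<times> real \<Rightarrow> 'a) \<Rightarrow> 'a set \<Rightarrow> real \<Rightarrow> 'a set \<Rightarrow> real" where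
  "mKL \<phi> orig K L A =
     1 / real (card (PK \<phi> K L (L + 5 * tauK \<phi> K))) *
     (\<Sum>\<gamma>\<in>PK \<phi> K L (L + 5 * tauK \<phi> K). measure (orbit_measure \<phi> orig \<gamma>) A)"

end

theory Submission
  imports Defs
begin

text \<open>
  Write \<open>P(L)\<close> for the set of periodic orbits that meet \<open>K0\<close>, with period in
  \<open>[L, L + 5\<tau>]\<close>, where \<open>\<tau> = tauK \<phi> K0\<close>. The mean of \<open>\<mu>\<^sub>\<gamma>(A)\<close> over \<open>P(L)\<close> is at least
  \<open>\<alpha>\<close> and all values are at most 1, so a fraction of at least \<open>(\<alpha> - \<alpha>') / (1 - \<alpha>')\<close> of the
  orbits satisfies \<open>\<mu>\<^sub>\<gamma>(A) \<ge> \<alpha>'\<close>. For such an orbit, the average over \<open>s \<in> [0, T0]\<close> of the number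
  of visits of \<open>A\<close> at the times \<open>s + i T0\<close> is at least \<open>\<alpha>' L / T0 - 2\<close>, which exceeds
  \<open>(\<alpha>' / 2) L / T0\<close> once \<open>L / T0\<close> is large (lemmas \<open>sampling\<close> and \<open>many_visits\<close>).

  It remains to discard the non-primitive orbits, and the main work is to show that they form a
  fraction \<open>O(1 / L)\<close> of \<open>P(L)\<close> (lemma \<open>non_primitive_rare\<close>). No exponential estimate is needed
  for this. Fix a closed orbit \<open>\<gamma>0\<close> of period \<open>\<tau>\<close> through a point \<open>x0\<close> of \<open>K0\<close>. Positive entropy
  is used only to see that \<open>\<gamma>0\<close> is not the whole manifold (lemma \<open>not_single_closed_orbit\<close>). By
  transitivity there is then an excursion: an orbit segment from near \<open>x0\<close> back to near \<open>x0\<close>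
  that leaves a neighbourhood of \<open>\<gamma>0\<close> and visits the interior of \<open>K0\<close>. A non-primitive orbit in
  \<open>P(L)\<close> has a period \<open>T \<le> (L + 5\<tau>) / 2\<close>. The pseudo-orbit that makes three excursions from
  \<open>\<gamma>0\<close> at chosen times, runs once along this loop of length \<open>T\<close>, and spends the remaining time on
  \<open>\<gamma>0\<close>, has a bounded number of segments. Shadowing and the closing lemma therefore produce an
  element of \<open>P(L)\<close> that traces it (lemma \<open>realize_itineraries\<close>). The times of the excursions can
  be chosen in a number of ways that grows like \<open>L\<^sup>3\<close>.

  Conversely, the element of \<open>P(L)\<close> determines the choices and the non-primitive orbit, if one
  also knows the phase at which the tracing starts, the number \<open>T\<close>, and the period of the original
  orbit, each up to a fixed error, and which of finitely many connecting segments were used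
  (lemma \<open>recover_itinerary\<close>). The times of the excursions are visible because the excursions
  leave \<open>\<gamma>0\<close>. The loop is determined by expansivity, since two closed orbits of almost equal
  periods that stay close during one period coincide (lemma \<open>closed_orbits_separated\<close>). The
  additional data take \<open>O(L\<^sup>2)\<close> values, which leaves a gain of a factor \<open>L\<close>.
\<close>

section \<open>Elementary properties of the flow\<close>

context H_flow
begin

lemma flow_0 [simp]: "\<phi> 0 x = x"
  using C1 by (simp add: C1_flow_def is_flow_def)

lemma flow_add: "\<phi> (s + t) x = \<phi> s (\<phi> t x)"
  using C1 by (simp add: C1_flow_def is_flow_def)

lemma continuous_flow: "continuous_on UNIV (\<lambda>p. \<phi> (fst p) (snd p))"
  using C1 by (simp add: C1_flow_def case_prod_beta)

lemma continuous_flow_time: "continuous_on UNIV (\<lambda>t. \<phi> t x)"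
proof -
  have "continuous_on UNIV ((\<lambda>p. \<phi> (fst p) (snd p)) \<circ> (\<lambda>t. (t, x)))"
    by (intro continuous_on_compose continuous_on_subset[OF continuous_flow] continuous_intros) auto
  then show ?thesis by (simp add: o_def)
qed

lemma continuous_flow_space: "continuous_on UNIV (\<phi> t)"
proof -
  have "continuous_on UNIV ((\<lambda>p. \<phi> (fst p) (snd p)) \<circ> (\<lambda>x. (t, x)))"
    by (intro continuous_on_compose continuous_on_subset[OF continuous_flow] continuous_intros) auto
  then show ?thesis by (simp add: o_def)
qed

lemma tendsto_flow:
  assumes "(f \<longlongrightarrow> t) F" "(g \<longlongrightarrow> x) F"
  shows "((\<lambda>n. \<phi> (f n) (g n)) \<longlongrightarrow> \<phi> t x) F"
proof -
  have "isCont (\<lambda>p. \<phi> (fst p) (snd p)) (t, x)"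
    using continuous_flow by (simp add: continuous_on_eq_continuous_at)
  from isCont_tendsto_compose[OF this tendsto_Pair[OF assms]] show ?thesis
    by simp
qed

lemma flow_period_nat:
  assumes "\<phi> T x = x"
  shows "\<phi> (of_nat k * T) x = x"
proof (induction k)
  case (Suc k)
  have "\<phi> (of_nat (Suc k) * T) x = \<phi> (of_nat k * T + T) x"
    by (simp add: algebra_simps)
  then show ?case using Suc assms by (simp only: flow_add)
qed simp

lemma flow_period_minus:
  assumes "\<phi> T x = x"
  shows "\<phi> (- T) x = x"
  by (metis add.left_inverse assms flow_0 flow_add)

lemma flow_period_int:
  assumes "\<phi> T x = x"
  shows "\<phi> (of_int k * T) x = x"
proof (cases "k \<ge> 0")
  case True
  then show ?thesis using flow_period_nat[OF assms, of "nat k"] by simp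
next
  case False
  then show ?thesis
    using flow_period_minus[OF flow_period_nat[OF assms, of "nat (- k)"]] by simp
qed

lemma flow_shift_period:
  assumes "\<phi> T x = x"
  shows "\<phi> (t + of_int k * T) x = \<phi> t x"
  using flow_period_int[OF assms, of k] by (simp add: flow_add)

text \<open>Reduction of a time modulo a positive period.\<close>

lemma flow_reduce:
  fixes T :: real
  assumes "\<phi> T x = x" "T > 0"
  obtains u where "0 \<le> u" "u < T" "\<phi> u x = \<phi> t x"
proof
  let ?k = "\<lfloor>t / T\<rfloor>"
  show "0 \<le> t - ?k * T" "t - ?k * T < T"
    using assms(2) floor_divide_lower[of T t] floor_divide_upper[of T t]
    by (simp_all add: algebra_simps)
  have "\<phi> ((t - ?k * T) + ?k * T) x = \<phi> (t - ?k * T) x"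
    by (rule flow_shift_period[OF assms(1)])
  then show "\<phi> (t - ?k * T) x = \<phi> t x" by simp
qed

lemma flow_orbit_flow: "flow_orbit \<phi> (\<phi> t x) = flow_orbit \<phi> x"
proof -
  have "\<phi> s x = \<phi> (s - t) (\<phi> t x)" "\<phi> s (\<phi> t x) = \<phi> (s + t) x" for s
    by (simp_all flip: flow_add)
  then show ?thesis unfolding flow_orbit_def by blast
qed

lemma flow_orbit_self: "x \<in> flow_orbit \<phi> x"
  unfolding flow_orbit_def by (metis flow_0 rangeI)

lemma flow_orbit_eq: "y \<in> flow_orbit \<phi> x \<Longrightarrow> flow_orbit \<phi> y = flow_orbit \<phi> x"
  by (auto simp: flow_orbit_def[of _ x] flow_orbit_flow)

lemma period_flow:
  assumes "\<phi> T x = x" shows "\<phi> T (\<phi> t x) = \<phi> t x"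
  by (metis add.commute assms flow_add)

lemma period_orbit:
  assumes "\<phi> T x = x" "y \<in> flow_orbit \<phi> x" shows "\<phi> T y = y"
  using assms by (auto simp: flow_orbit_def period_flow)

lemma periodic_orbitsD:
  assumes "\<gamma> \<in> periodic_orbits \<phi>" "y \<in> fst \<gamma>"
  shows "fst \<gamma> = flow_orbit \<phi> y" "\<phi> (snd \<gamma>) y = y" "snd \<gamma> > 0"
  using assms flow_orbit_eq period_orbit by (auto simp: periodic_orbits_def)

text \<open>The infinitesimal upper bound on the speed integrates along orbits.\<close>

lemma speed_bound:
  obtains b where "b > 0" "\<And>x s t. dist (\<phi> s x) (\<phi> t x) \<le> b * \<bar>s - t\<bar>"
proof -
  from speed obtain a b where ab: "0 < a" "a \<le> b"
    and loc: "\<And>x. \<exists>\<rho>>0. \<forall>t\<in>{-\<rho>..\<rho>}. dist x (\<phi> t x) \<le> b * \<bar>t\<bar>"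
    by meson
  have le: "dist (\<phi> s x) (\<phi> t x) \<le> b * (t - s)" if "s \<le> t" for s t x
  proof (rule Bolzano[OF that])
    fix s t u assume "dist (\<phi> s x) (\<phi> t x) \<le> b * (t - s)" "dist (\<phi> t x) (\<phi> u x) \<le> b * (u - t)"
    then show "dist (\<phi> s x) (\<phi> u x) \<le> b * (u - s)"
      using dist_triangle[of "\<phi> s x" "\<phi> u x" "\<phi> t x"] by (simp add: algebra_simps)
  next
    fix c
    from loc[of "\<phi> c x"] obtain \<rho> where \<rho>: "\<rho> > 0"
      and le: "\<And>t. \<bar>t\<bar> \<le> \<rho> \<Longrightarrow> dist (\<phi> c x) (\<phi> t (\<phi> c x)) \<le> b * \<bar>t\<bar>"
      by (auto simp: abs_le_iff)
    have le': "dist (\<phi> c x) (\<phi> t x) \<le> b * \<bar>t - c\<bar>" if "\<bar>t - c\<bar> \<le> \<rho>" for t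
      using le[OF that] by (simp flip: flow_add)
    have "dist (\<phi> s x) (\<phi> t x) \<le> b * (t - s)" if "s \<le> c" "c \<le> t" "t - s < \<rho>" for s t
      using le'[of s] le'[of t] that dist_triangle2[of "\<phi> s x" "\<phi> t x" "\<phi> c x"]
      by (simp add: dist_commute algebra_simps)
    then show "\<exists>d>0. \<forall>s t. s \<le> c \<and> c \<le> t \<and> t - s < d \<longrightarrow> dist (\<phi> s x) (\<phi> t x) \<le> b * (t - s)"
      using \<rho> by blast
  qed
  show thesis
  proof (rule that)
    show "b > 0" using ab by simp
    show "dist (\<phi> s x) (\<phi> t x) \<le> b * \<bar>s - t\<bar>" for x s t
      using le[of s t x] le[of t s x] by (cases "s \<le> t") (auto simp: dist_commute)
  qed
qed

lemma no_fixed_point: "\<exists>t. \<phi> t x \<noteq> x"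
proof -
  from speed obtain a \<rho> where "0 < a" "\<rho> > 0" "\<forall>t\<in>{-\<rho>..\<rho>}. a * \<bar>t\<bar> \<le> dist x (\<phi> t x)"
    by meson
  moreover from this have "\<rho> \<in> {-\<rho>..\<rho>}" by simp
  ultimately have "a * \<bar>\<rho>\<bar> \<le> dist x (\<phi> \<rho> x)" "0 < a * \<bar>\<rho>\<bar>" by (blast, simp)
  then have "0 < dist x (\<phi> \<rho> x)" by linarith
  then show ?thesis by (intro exI[of _ \<rho>]) auto
qed

text \<open>Local compactness, inherited from the charts.\<close>

lemma compact_neighbourhood:
  fixes K :: "'a set"
  assumes "compact K"
  obtains K' r where "compact K'" "r > 0" "\<And>x. x \<in> K \<Longrightarrow> ball x r \<subseteq> K'"
proof -
  have loc: "\<exists>U. open U \<and> x \<in> U \<and> compact (closure U)" for x :: 'a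
  proof -
    have "x \<in> (\<Union>c\<in>\<A>. cdom c)" using atlas by (simp add: riemannian_atlas_def)
    then obtain c where c: "c \<in> \<A>" "x \<in> cdom c" by blast
    then have o: "open (cdom c)" "open (cmap c ` cdom c)"
      and h: "homeomorphism (cdom c) (cmap c ` cdom c) (cmap c) (cinv c)"
      using atlas by (auto simp: riemannian_atlas_def)
    obtain e where e: "e > 0" "cball (cmap c x) e \<subseteq> cmap c ` cdom c"
      using o(2) c(2) by (meson image_eqI open_contains_cball)
    let ?U = "cdom c \<inter> cmap c -` ball (cmap c x) e"
    have "open ?U"
      using h o(1) by (intro continuous_open_preimage) (auto simp: homeomorphism_def)
    moreover have "?U \<subseteq> cinv c ` cball (cmap c x) e"
    proof
      fix y assume "y \<in> ?U"
      then show "y \<in> cinv c ` cball (cmap c x) e"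
        using h by (intro image_eqI[of _ _ "cmap c y"]) (auto simp: homeomorphism_def)
    qed
    moreover have C: "compact (cinv c ` cball (cmap c x) e)"
      using h e(2) by (intro compact_continuous_image)
        (auto simp: homeomorphism_def intro: continuous_on_subset)
    ultimately have "closure ?U \<subseteq> cinv c ` cball (cmap c x) e"
      using compact_imp_closed closure_minimal by metis
    then have "compact (closure ?U)"
      using C by (metis closed_closure compact_Int_closed inf.absorb_iff2)
    then show ?thesis using \<open>open ?U\<close> c(2) e(1) by (intro exI[of _ ?U]) auto
  qed
  obtain D where D: "D \<subseteq> {U. open U \<and> compact (closure U)}" "finite D" "K \<subseteq> \<Union>D"
  proof (rule compactE[OF assms, of "{U. open U \<and> compact (closure U)}"])
    show "K \<subseteq> \<Union>{U. open U \<and> compact (closure U)}" using loc by blast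
  qed auto
  then have "open (\<Union>D)" by blast
  from compact_subset_open_imp_ball_epsilon_subset[OF assms this D(3)]
  obtain r where r: "r > 0" "(\<Union>x\<in>K. ball x r) \<subseteq> \<Union>D" by blast
  show thesis
  proof (rule that[of "\<Union>(closure ` D)" r])
    show "compact (\<Union>(closure ` D))" using D by blast
    show "ball x r \<subseteq> \<Union>(closure ` D)" if "x \<in> K" for x
      using that r closure_subset by blast
  qed (use r in auto)
qed

section \<open>Periods of the closed orbits that meet a compact set\<close>

text \<open>A limit of points with periods tending to 0 would be a fixed point of the flow.\<close>

lemma periods_bounded_below:
  assumes "compact K"
  obtains p where "p > 0" "\<And>x T. x \<in> K \<Longrightarrow> T > 0 \<Longrightarrow> \<phi> T x = x \<Longrightarrow> T \<ge> p"
proof -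
  obtain b where b: "b > 0" "\<And>x s t. dist (\<phi> s x) (\<phi> t x) \<le> b * \<bar>s - t\<bar>"
    using speed_bound by blast
  have "\<exists>p>0. \<forall>x T. x \<in> K \<longrightarrow> T > 0 \<longrightarrow> \<phi> T x = x \<longrightarrow> T \<ge> p"
  proof (rule ccontr)
    assume "\<not> ?thesis"
    then have "\<forall>n. \<exists>x T. x \<in> K \<and> T > 0 \<and> \<phi> T x = x \<and> T < inverse (real (Suc n))"
      by (meson inverse_positive_iff_positive not_less of_nat_0_less_iff zero_less_Suc)
    then obtain x T where xT: "\<And>n. x n \<in> K" "\<And>n. T n > 0" "\<And>n. \<phi> (T n) (x n) = x n"
      "\<And>n. T n < inverse (real (Suc n))"
      by metis
    from assms xT(1) obtain l r where l: "l \<in> K" "strict_mono r" "(x \<circ> r) \<longlonglongrightarrow> l"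
      by (metis compact_def)
    have "T \<longlonglongrightarrow> 0"
      by (rule real_tendsto_sandwich[OF _ _ tendsto_const LIMSEQ_inverse_real_of_nat])
        (use xT in \<open>auto simp: less_imp_le intro!: always_eventually\<close>)
    then have T0: "(T \<circ> r) \<longlonglongrightarrow> 0" using l(2) LIMSEQ_subseq_LIMSEQ by blast
    have "\<phi> t l = l" for t
    proof -
      have "dist (\<phi> t y) y \<le> b * T'" if y: "\<phi> T' y = y" "T' > 0" for y T'
      proof -
        obtain u where u: "0 \<le> u" "u < T'" "\<phi> u y = \<phi> t y"
          using flow_reduce y by blast
        have "dist (\<phi> u y) (\<phi> 0 y) \<le> b * \<bar>u - 0\<bar>" by (rule b(2))
        also have "\<dots> \<le> b * T'" using u b(1) by simp
        finally show ?thesis using u by simp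
      qed
      then have "dist (\<phi> t ((x \<circ> r) n)) ((x \<circ> r) n) \<le> b * (T \<circ> r) n" for n
        using xT by simp
      moreover have "(\<lambda>n. dist (\<phi> t ((x \<circ> r) n)) ((x \<circ> r) n)) \<longlonglongrightarrow> dist (\<phi> t l) l"
        by (intro tendsto_dist tendsto_flow tendsto_const l(3))
      moreover have "(\<lambda>n. b * (T \<circ> r) n) \<longlonglongrightarrow> b * 0"
        by (intro tendsto_mult tendsto_const T0)
      ultimately have "dist (\<phi> t l) l \<le> b * 0"
        using LIMSEQ_le by blast
      then show ?thesis by simp
    qed
    then show False using no_fixed_point by blast
  qed
  then show thesis using that by blast
qed

text \<open>A recurrent point close to an interior point closes up.\<close>

lemma ex_closed_orbit:
  assumes "interior K \<noteq> {}"
  shows "\<exists>x T. x \<in> K \<and> T \<ge> 1 \<and> \<phi> T x = x"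
proof -
  from assms obtain c r where c: "r > 0" "ball c r \<subseteq> K"
    by (meson all_not_in_conv mem_interior)
  define \<epsilon> where "\<epsilon> = min 1 (r / 2)"
  have \<epsilon>: "\<epsilon> > 0" "\<epsilon> \<le> 1" "2 * \<epsilon> \<le> r" using c by (auto simp: \<epsilon>_def)
  from closing_lemma[OF \<epsilon>(1), of c] obtain \<delta> Tmin where d: "\<delta> > 0" "Tmin > 0"
    and cl: "\<And>y t. y \<in> ball c \<epsilon> \<Longrightarrow> t \<ge> Tmin \<Longrightarrow> dist (\<phi> t y) y \<le> \<delta> \<Longrightarrow>
           (\<exists>z\<in>ball y \<epsilon>. \<exists>\<tau>\<in>{t - \<epsilon>..t + \<epsilon>}. \<phi> \<tau> z = z)"
    by meson
  define \<rho> where "\<rho> = min \<epsilon> (\<delta> / 2)"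
  have \<rho>: "\<rho> > 0" using \<epsilon> d by (simp add: \<rho>_def)
  have "\<exists>t\<ge>max Tmin 2. \<phi> t ` ball c \<rho> \<inter> ball c \<rho> \<noteq> {}"
    by (rule transitivity) (use \<rho> d in auto)
  then obtain t where t: "t \<ge> max Tmin 2" "\<phi> t ` ball c \<rho> \<inter> ball c \<rho> \<noteq> {}"
    by blast
  then obtain y where y: "dist c y < \<rho>" "dist c (\<phi> t y) < \<rho>" by auto
  have "dist (\<phi> t y) y \<le> \<delta>"
    using y dist_triangle3[of "\<phi> t y" y c] by (simp add: \<rho>_def)
  with cl[of y t] y t obtain z \<tau> where z: "dist y z < \<epsilon>" "\<tau> \<ge> t - \<epsilon>" "\<phi> \<tau> z = z"
    by (auto simp: \<rho>_def)
  have "dist c z < r" using y z \<epsilon> dist_triangle[of c z y] by (simp add: \<rho>_def)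
  then show ?thesis using c z t \<epsilon> by (intro exI[of _ z] exI[of _ \<tau>]) auto
qed

text \<open>The least period in the definition of \<open>tauK\<close> exists, by compactness.\<close>

lemma tauK_attained:
  assumes "compact K" "interior K \<noteq> {}"
  obtains x where "x \<in> K" "\<phi> (tauK \<phi> K) x = x" "tauK \<phi> K \<ge> 1"
proof -
  define S where "S = {T. T \<ge> 1 \<and> (\<exists>x\<in>K. \<phi> T x = x)}"
  have S_eq: "(\<exists>\<gamma>\<in>periodic_orbits \<phi>. period \<gamma> = T \<and> T \<ge> 1 \<and> fst \<gamma> \<inter> K \<noteq> {}) \<longleftrightarrow> T \<in> S" for T
  proof
    assume "\<exists>\<gamma>\<in>periodic_orbits \<phi>. period \<gamma> = T \<and> T \<ge> 1 \<and> fst \<gamma> \<inter> K \<noteq> {}"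
    then show "T \<in> S" unfolding S_def using periodic_orbitsD(2) by auto
  next
    assume "T \<in> S"
    then obtain x where "x \<in> K" "T \<ge> 1" "\<phi> T x = x" by (auto simp: S_def)
    then show "\<exists>\<gamma>\<in>periodic_orbits \<phi>. period \<gamma> = T \<and> T \<ge> 1 \<and> fst \<gamma> \<inter> K \<noteq> {}"
      using flow_orbit_self[of x]
      by (intro bexI[of _ "(flow_orbit \<phi> x, T)"]) (auto simp: periodic_orbits_def)
  qed
  have ne: "S \<noteq> {}" using ex_closed_orbit[OF assms(2)] by (auto simp: S_def)
  have bd: "bdd_below S" by (auto simp: S_def intro: bdd_belowI)
  have "closed S"
    unfolding closed_sequential_limits
  proof (intro allI impI, elim conjE)
    fix T l assume T: "\<forall>n. T n \<in> S" "T \<longlonglongrightarrow> l"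
    then obtain x where x: "\<And>n. x n \<in> K" "\<And>n. \<phi> (T n) (x n) = x n" "\<And>n. T n \<ge> 1"
      unfolding S_def by (auto; metis)
    from assms(1) x(1) obtain y r where y: "y \<in> K" "strict_mono r" "(x \<circ> r) \<longlonglongrightarrow> y"
      by (metis compact_def)
    have "(\<lambda>n. \<phi> ((T \<circ> r) n) ((x \<circ> r) n)) \<longlonglongrightarrow> \<phi> l y"
      by (intro tendsto_flow y(3) LIMSEQ_subseq_LIMSEQ T(2) y(2))
    moreover have "(\<lambda>n. \<phi> ((T \<circ> r) n) ((x \<circ> r) n)) = x \<circ> r" using x by auto
    ultimately have "\<phi> l y = y" using y(3) LIMSEQ_unique by metis
    moreover have "l \<ge> 1" using T(2) x(3) by (intro LIMSEQ_le_const) auto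
    ultimately show "l \<in> S" using y(1) by (auto simp: S_def)
  qed
  then have inf: "Inf S \<in> S" using closed_contains_Inf[OF ne bd] by simp
  have "tauK \<phi> K = Inf S"
    unfolding tauK_def S_eq
    by (rule Least_equality[of "\<lambda>T. T \<in> S", OF inf]) (use bd in \<open>auto intro: cInf_lower\<close>)
  then show thesis using inf that by (auto simp: S_def)
qed

lemma same_cell_close:
  fixes s t :: real
  assumes "\<sigma> > 0" "0 \<le> s" "0 \<le> t" "nat \<lfloor>s / \<sigma>\<rfloor> = nat \<lfloor>t / \<sigma>\<rfloor>"
  shows "\<bar>s - t\<bar> < \<sigma>"
proof -
  have "\<lfloor>s / \<sigma>\<rfloor> = \<lfloor>t / \<sigma>\<rfloor>" using assms by (simp add: eq_nat_nat_iff)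
  then have "\<bar>s / \<sigma> - t / \<sigma>\<bar> < 1" by linarith
  then show ?thesis using assms(1) by (simp add: field_simps abs_if split: if_splits)
qed

lemma finite_separated:
  fixes S :: "real set"
  assumes p: "p > 0" and sub: "S \<subseteq> {L..L + \<sigma>}"
    and sep: "\<And>s t. s \<in> S \<Longrightarrow> t \<in> S \<Longrightarrow> \<bar>s - t\<bar> < p \<Longrightarrow> s = t"
  shows "finite S" "card S \<le> nat \<lfloor>\<sigma> / p\<rfloor> + 1"
proof -
  define f where "f s = nat \<lfloor>(s - L) / p\<rfloor>" for s
  have "inj_on f S"
  proof
    fix s t assume st: "s \<in> S" "t \<in> S" "f s = f t"
    then have "\<bar>(s - L) - (t - L)\<bar> < p"
      using sub by (intro same_cell_close[OF p]) (auto simp: f_def)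
    then show "s = t" using sep st by simp
  qed
  moreover have "f ` S \<subseteq> {..nat \<lfloor>\<sigma> / p\<rfloor>}"
    using sub p by (auto simp: f_def intro!: nat_mono floor_mono divide_right_mono)
  ultimately show "finite S" "card S \<le> nat \<lfloor>\<sigma> / p\<rfloor> + 1"
    using inj_on_finite[of f S] card_inj_on_le[of f S "{..nat \<lfloor>\<sigma> / p\<rfloor>}"] by auto
qed

text \<open>If the manifold consisted of one closed orbit, its multiples would be the only periodic
  orbits, and their number in a window of fixed length stays bounded.\<close>

lemma not_single_closed_orbit:
  assumes "\<phi> T x = x" "T > 0" "\<sigma> > 0" "h_Gur \<phi> K \<sigma> > 0"
  shows "flow_orbit \<phi> x \<noteq> UNIV"
proof
  assume U: "flow_orbit \<phi> x = UNIV"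
  obtain p where p: "p > 0" "\<And>y T. y \<in> {x} \<Longrightarrow> T > 0 \<Longrightarrow> \<phi> T y = y \<Longrightarrow> T \<ge> p"
    using periods_bounded_below[of "{x}"] by auto
  define B where "B = nat \<lfloor>\<sigma> / p\<rfloor> + 1"
  have card: "finite (PK \<phi> K L (L + \<sigma>)) \<and> card (PK \<phi> K L (L + \<sigma>)) \<le> B" for L
  proof -
    define S where "S = {T \<in> {L..L+\<sigma>}. \<phi> T x = x}"
    have fst_eq: "fst \<gamma> = UNIV" "\<phi> (snd \<gamma>) x = x" if \<gamma>: "\<gamma> \<in> periodic_orbits \<phi>" for \<gamma>
    proof -
      obtain y where "fst \<gamma> = flow_orbit \<phi> y" "\<phi> (snd \<gamma>) y = y"
        using \<gamma> by (auto simp: periodic_orbits_def)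
      then show "fst \<gamma> = UNIV" "\<phi> (snd \<gamma>) x = x"
        using U flow_orbit_eq[of y x] period_orbit[of "snd \<gamma>" y x] by auto
    qed
    have sep: "s = t" if "s \<in> S" "t \<in> S" "\<bar>s - t\<bar> < p" for s t
    proof (rule ccontr)
      assume "s \<noteq> t"
      have *: "\<phi> (u - v) x = x" if "u \<in> S" "v \<in> S" for u v
        using that flow_period_minus[of v x] flow_add[of u "- v" x] by (simp add: S_def)
      show False
        using p(2)[of x "s - t"] p(2)[of x "t - s"] *[of s t] *[of t s] that \<open>s \<noteq> t\<close>
        by (cases "s < t") auto
    qed
    have "S \<subseteq> {L..L+\<sigma>}" by (auto simp: S_def)
    from finite_separated[OF p(1) this sep] have fin: "finite S" "card S \<le> B"
      by (simp_all add: B_def)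
    have sub: "PK \<phi> K L (L + \<sigma>) \<subseteq> Pair UNIV ` S"
      using fst_eq by (force simp: PK_def S_def image_iff)
    have "card (Pair (UNIV :: 'a set) ` S) \<le> card S" by (rule card_image_le[OF fin(1)])
    then show ?thesis
      using card_mono[OF _ sub] finite_subset[OF sub] fin by auto
  qed
  have le: "log_card (PK \<phi> K L (L + \<sigma>)) / ereal L \<le> ereal (ln (real B) / L)" if "L > 0" for L
  proof -
    have "ln (real (card X)) \<le> ln (real B)" if "card X \<le> B" "card X > 0" for X :: "('a set \<times> real) set"
      using that by (intro ln_mono) auto
    then have "log_card (PK \<phi> K L (L + \<sigma>)) \<le> ereal (ln (real B))"
      using card[of L] by (auto simp: log_card_def card_gt_0_iff)
    then have "log_card (PK \<phi> K L (L + \<sigma>)) / ereal L \<le> ereal (ln (real B)) / ereal L"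
      using that by (intro ereal_divide_right_mono) auto
    then show ?thesis using that by simp
  qed
  have "((\<lambda>L. ln (real B) / L) \<longlongrightarrow> 0) at_top"
    by (intro tendsto_divide_0[OF tendsto_const] filterlim_at_top_imp_at_infinity filterlim_ident)
  then have "((\<lambda>L. ereal (ln (real B) / L)) \<longlongrightarrow> 0) at_top"
    by (simp add: zero_ereal_def)
  then have "Limsup at_top (\<lambda>L. ereal (ln (real B) / L)) = 0"
    by (intro lim_imp_Limsup) auto
  moreover have "h_Gur \<phi> K \<sigma> \<le> Limsup at_top (\<lambda>L. ereal (ln (real B) / L))"
    unfolding h_Gur_def
    by (intro Limsup_mono eventually_mono[OF eventually_gt_at_top[of 0]] le)
  ultimately show False using assms(4) by simp
qed

end

section \<open>Pseudo-orbits and shadowing\<close>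

text \<open>A pseudo-orbit is a list of pairs \<open>(x, t)\<close>, each standing for the orbit segment of
  \<open>x\<close> of duration \<open>t\<close>. In \<open>chain \<phi> \<eta>\<close> every segment ends within \<open>\<eta>\<close> of the start of the next one;
  in \<open>traces \<phi> \<kappa> y\<close> the orbit of \<open>y\<close> runs along the segments one after the other, at distance
  less than \<open>\<kappa>\<close>.\<close>

definition duration :: "('a \<times> real) list \<Rightarrow> real" where
  "duration ps = sum_list (map snd ps)"

definition chain :: "(real \<Rightarrow> 'a::metric_space \<Rightarrow> 'a) \<Rightarrow> real \<Rightarrow> ('a \<times> real) list \<Rightarrow> bool" where
  "chain \<phi> \<eta> ps \<longleftrightarrow> successively (\<lambda>p q. dist (\<phi> (snd p) (fst p)) (fst q) < \<eta>) ps"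

primrec traces :: "(real \<Rightarrow> 'a::metric_space \<Rightarrow> 'a) \<Rightarrow> real \<Rightarrow> 'a \<Rightarrow> ('a \<times> real) list \<Rightarrow> bool" where
  "traces \<phi> \<kappa> y [] \<longleftrightarrow> True"
| "traces \<phi> \<kappa> y (p # ps) \<longleftrightarrow>
     (\<forall>s\<in>{0..snd p}. dist (\<phi> s y) (\<phi> s (fst p)) < \<kappa>) \<and> traces \<phi> \<kappa> (\<phi> (snd p) y) ps"

lemma duration_simps [simp]:
  "duration [] = 0" "duration (p # ps) = snd p + duration ps"
  "duration (ps @ qs) = duration ps + duration qs"
  by (simp_all add: duration_def)

lemma duration_nonneg: "(\<And>p. p \<in> set ps \<Longrightarrow> snd p \<ge> 0) \<Longrightarrow> duration ps \<ge> 0"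
  unfolding duration_def by (rule sum_list_nonneg) auto

text \<open>A block of length \<open>n R + t\<close> consists of \<open>a R\<close> units of time on the orbit of \<open>x\<close>, the
  excursion \<open>(e, t)\<close>, and \<open>(n - a) R\<close> units of time on the orbit of \<open>x\<close>. Its duration does not
  depend on \<open>a\<close>.\<close>

definition block :: "'a \<Rightarrow> 'a \<Rightarrow> real \<Rightarrow> real \<Rightarrow> nat \<Rightarrow> nat \<Rightarrow> ('a \<times> real) list" where
  "block x e t R n a = [(x, real a * R), (e, t), (x, real (n - a) * R)]"

lemma duration_block: "a \<le> n \<Longrightarrow> duration (block x e t R n a) = real n * R + t"
  by (simp add: block_def of_nat_diff algebra_simps)

text \<open>\<open>separates_closed_orbits \<phi> \<epsilon>\<close>: closed orbits of periods \<open>T \<le> T'\<close> that stay \<open>\<epsilon>\<close>-close for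
  the time \<open>T\<close>, under all time shifts up to \<open>T' - T\<close>, are equal as sets.\<close>

definition separates_closed_orbits :: "(real \<Rightarrow> 'a::metric_space \<Rightarrow> 'a) \<Rightarrow> real \<Rightarrow> bool" where
  "separates_closed_orbits \<phi> \<epsilon> \<longleftrightarrow>
     (\<forall>x y T T'. \<phi> T x = x \<and> \<phi> T' y = y \<and> 0 < T \<and> T \<le> T' \<and>
        (\<forall>s v. 0 \<le> s \<and> s \<le> T \<and> \<bar>v\<bar> \<le> T' - T \<longrightarrow> dist (\<phi> s x) (\<phi> (s + v) y) \<le> \<epsilon>) \<longrightarrow>
        y \<in> flow_orbit \<phi> x)"

context H_flow
begin

lemma traces_append:
  "traces \<phi> \<kappa> y (ps @ qs) \<longleftrightarrow> traces \<phi> \<kappa> y ps \<and> traces \<phi> \<kappa> (\<phi> (duration ps) y) qs"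
proof (induction ps arbitrary: y)
  case (Cons p ps)
  then show ?case by (simp add: add.commute[of "snd p"] flow_add)
qed simp

lemma traces_nthI:
  assumes "\<And>i s. i < length ps \<Longrightarrow> 0 \<le> s \<Longrightarrow> s \<le> snd (ps ! i) \<Longrightarrow>
             dist (\<phi> (s + duration (take i ps)) y) (\<phi> s (fst (ps ! i))) < \<kappa>"
  shows "traces \<phi> \<kappa> y ps"
  using assms
proof (induction ps arbitrary: y)
  case (Cons p ps)
  have "traces \<phi> \<kappa> (\<phi> (snd p) y) ps"
  proof (rule Cons.IH)
    fix i s assume "i < length ps" "0 \<le> s" "s \<le> snd (ps ! i)"
    then show "dist (\<phi> (s + duration (take i ps)) (\<phi> (snd p) y)) (\<phi> s (fst (ps ! i))) < \<kappa>"
      using Cons.prems[of "Suc i" s] by (simp add: algebra_simps flip: flow_add)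
  qed
  then show ?case using Cons.prems[of 0] by simp
qed simp

lemma traces_perturb:
  assumes "traces \<phi> \<kappa> y ps" "\<And>p. p \<in> set ps \<Longrightarrow> snd p \<ge> 0"
    and "\<And>s. 0 \<le> s \<Longrightarrow> s \<le> duration ps \<Longrightarrow> dist (\<phi> s z) (\<phi> s y) \<le> \<epsilon>"
  shows "traces \<phi> (\<kappa> + \<epsilon>) z ps"
  using assms
proof (induction ps arbitrary: y z)
  case (Cons p ps)
  have nn: "snd p \<ge> 0" "duration ps \<ge> 0" using Cons.prems(2) by (simp_all add: duration_nonneg)
  have "traces \<phi> (\<kappa> + \<epsilon>) (\<phi> (snd p) z) ps"
  proof (rule Cons.IH)
    show "traces \<phi> \<kappa> (\<phi> (snd p) y) ps" using Cons.prems(1) by simp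
    show "dist (\<phi> s (\<phi> (snd p) z)) (\<phi> s (\<phi> (snd p) y)) \<le> \<epsilon>" if "0 \<le> s" "s \<le> duration ps" for s
      using Cons.prems(3)[of "s + snd p"] that nn by (simp add: flow_add)
  qed (use Cons.prems(2) in auto)
  moreover have "dist (\<phi> s z) (\<phi> s (fst p)) < \<kappa> + \<epsilon>" if "s \<in> {0..snd p}" for s
  proof -
    have "dist (\<phi> s z) (\<phi> s y) \<le> \<epsilon>" using Cons.prems(3)[of s] that nn by simp
    moreover have "dist (\<phi> s y) (\<phi> s (fst p)) < \<kappa>" using Cons.prems(1) that by simp
    ultimately show ?thesis using dist_triangle[of "\<phi> s z" "\<phi> s (fst p)" "\<phi> s y"] by linarith
  qed
  ultimately show ?case by simp
qed simp

text \<open>Finite exact shadowing, restated for pseudo-orbits given as lists.\<close>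

lemma shadowing_list:
  assumes "compact K" "\<delta> > 0" "N \<ge> 1"
  obtains \<eta> where "\<eta> > 0"
    "\<And>ps. length ps = N \<Longrightarrow> fst ` set ps \<subseteq> K \<Longrightarrow> \<forall>p\<in>set ps. snd p \<ge> 0 \<Longrightarrow>
       chain \<phi> \<eta> ps \<Longrightarrow> \<exists>y. traces \<phi> \<delta> y ps"
proof -
  from finite_exact_shadowing[OF assms] obtain \<eta> where \<eta>: "\<eta> > 0"
    and sh: "\<forall>(x :: nat \<Rightarrow> 'a) (t :: nat \<Rightarrow> real).
           (\<forall>i\<in>{1..N}. x i \<in> K \<and> t i \<ge> 0) \<and>
           (\<forall>i\<in>{1..<N}. dist (\<phi> (t i) (x i)) (x (i + 1)) < \<eta>) \<longrightarrow>
           (\<exists>y. \<forall>i\<in>{1..N}. \<forall>s\<in>{0..t i}. dist (\<phi> (s + (\<Sum>j\<in>{1..<i}. t j)) y) (\<phi> s (x i)) < \<delta>)"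
    by (elim exE conjE)
  show thesis
  proof (rule that[OF \<eta>])
    fix ps assume len: "length ps = N" and K: "fst ` set ps \<subseteq> K"
      and nn: "\<forall>p\<in>set ps. snd p \<ge> 0" and ch: "chain \<phi> \<eta> ps"
    \<comment> \<open>The shadowing property numbers the segments from 1.\<close>
    define x where "x i = fst (ps ! (i - 1))" for i
    define t where "t i = snd (ps ! (i - 1))" for i
    have "\<exists>y. \<forall>i\<in>{1..N}. \<forall>s\<in>{0..t i}. dist (\<phi> (s + (\<Sum>j\<in>{1..<i}. t j)) y) (\<phi> s (x i)) < \<delta>"
    proof (rule sh[rule_format], intro conjI)
      show "\<forall>i\<in>{1..N}. x i \<in> K \<and> t i \<ge> 0"
      proof
        fix i assume "i \<in> {1..N}"
        then have "ps ! (i - 1) \<in> set ps" using len by (intro nth_mem) auto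
        then show "x i \<in> K \<and> t i \<ge> 0" using K nn unfolding x_def t_def by blast
      qed
      show "\<forall>i\<in>{1..<N}. dist (\<phi> (t i) (x i)) (x (i + 1)) < \<eta>"
      proof
        fix i assume i: "i \<in> {1..<N}"
        have "dist (\<phi> (snd (ps ! (i - 1))) (fst (ps ! (i - 1)))) (fst (ps ! Suc (i - 1))) < \<eta>"
          using ch len i unfolding chain_def successively_conv_nth
          by (elim allE[of _ "i - 1"] impE) auto
        then show "dist (\<phi> (t i) (x i)) (x (i + 1)) < \<eta>"
          using i by (simp add: x_def t_def)
      qed
    qed
    then obtain y where y: "\<And>i s. i \<in> {1..N} \<Longrightarrow> s \<in> {0..t i} \<Longrightarrow>
        dist (\<phi> (s + (\<Sum>j\<in>{1..<i}. t j)) y) (\<phi> s (x i)) < \<delta>" by blast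
    have sum: "(\<Sum>j\<in>{1..<Suc i}. t j) = duration (take i ps)" if "i \<le> N" for i
      using that
    proof (induction i)
      case (Suc i)
      then show ?case using len by (simp add: t_def take_Suc_conv_app_nth)
    qed simp
    have "traces \<phi> \<delta> y ps"
    proof (rule traces_nthI)
      fix i s assume "i < length ps" "0 \<le> s" "s \<le> snd (ps ! i)"
      then show "dist (\<phi> (s + duration (take i ps)) y) (\<phi> s (fst (ps ! i))) < \<delta>"
        using y[of "Suc i" s] sum[of i] len by (simp add: x_def t_def)
    qed
    then show "\<exists>y. traces \<phi> \<delta> y ps" by blast
  qed
qed

lemma transitivity_open:
  assumes "open U" "U \<noteq> {}" "open V" "V \<noteq> {}"
  obtains W t where "open W" "W \<noteq> {}" "W \<subseteq> U" "t \<ge> 0" "\<phi> t ` W \<subseteq> V"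
proof -
  have "\<exists>t\<ge>1. \<phi> t ` U \<inter> V \<noteq> {}"
    by (rule transitivity) (use assms in auto)
  then obtain t where t: "t \<ge> 1" "\<phi> t ` U \<inter> V \<noteq> {}" by blast
  have "open (\<phi> t -` V)" using continuous_flow_space assms(3) by (simp add: open_vimage)
  then show thesis
    using that[of "U \<inter> \<phi> t -` V" t] t assms by auto
qed

lemma connecting_segment:
  assumes "\<eta> > 0" "\<eta>' > 0"
  obtains p t where "dist x p < \<eta>" "t \<ge> 0" "dist (\<phi> t p) y < \<eta>'"
proof -
  obtain W t where W: "W \<noteq> {}" "W \<subseteq> ball x \<eta>" "t \<ge> 0" "\<phi> t ` W \<subseteq> ball y \<eta>'"
    by (rule transitivity_open[of "ball x \<eta>" "ball y \<eta>'"]) (use assms in auto)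
  then obtain p where "p \<in> W" by blast
  then show thesis using W that[of p t] by (auto simp: dist_commute subset_iff)
qed

text \<open>A single orbit segment that starts and ends near \<open>x\<close> and passes near \<open>q\<close> and near \<open>y\<close>.\<close>

lemma excursion:
  assumes "\<eta> > 0" "\<rho> > 0"
  obtains e t s u where "dist x e < \<eta>" "dist (\<phi> t e) x < \<eta>" "0 \<le> s" "s \<le> t" "0 \<le> u" "u \<le> t"
    "dist q (\<phi> s e) < \<rho>" "dist y (\<phi> u e) < \<rho>"
proof -
  obtain W1 t1 where 1: "open W1" "W1 \<noteq> {}" "W1 \<subseteq> ball x \<eta>" "t1 \<ge> 0" "\<phi> t1 ` W1 \<subseteq> ball q \<rho>"
    by (rule transitivity_open[of "ball x \<eta>" "ball q \<rho>"]) (use assms in auto)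
  have o: "open (\<phi> t ` W)" if "open W" for t W
  proof -
    have "\<phi> t ` W = \<phi> (-t) -` W"
    proof safe
      fix y assume "\<phi> (-t) y \<in> W"
      moreover have "y = \<phi> t (\<phi> (-t) y)" by (simp flip: flow_add)
      ultimately show "y \<in> \<phi> t ` W" by blast
    qed (simp flip: flow_add)
    then show ?thesis using continuous_flow_space that by (simp add: open_vimage)
  qed
  obtain W2 t2 where 2: "open W2" "W2 \<noteq> {}" "W2 \<subseteq> \<phi> t1 ` W1" "t2 \<ge> 0" "\<phi> t2 ` W2 \<subseteq> ball y \<rho>"
    by (rule transitivity_open[of "\<phi> t1 ` W1" "ball y \<rho>"]) (use assms 1 o in auto)
  obtain W3 t3 where 3: "W3 \<noteq> {}" "W3 \<subseteq> \<phi> t2 ` W2" "t3 \<ge> 0" "\<phi> t3 ` W3 \<subseteq> ball x \<eta>"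
    by (rule transitivity_open[of "\<phi> t2 ` W2" "ball x \<eta>"]) (use assms 2 o in auto)
  obtain w where "w \<in> W3" using 3 by blast
  then obtain e where e: "e \<in> W1" "\<phi> t1 e \<in> W2" "w = \<phi> t2 (\<phi> t1 e)" using 2 3 by blast
  show thesis
  proof (rule that[of e "t3 + (t2 + t1)" t1 "t2 + t1"])
    show "dist x e < \<eta>" "dist q (\<phi> t1 e) < \<rho>" using e 1 by auto
    show "dist y (\<phi> (t2 + t1) e) < \<rho>" using e 2 by (auto simp: flow_add)
    show "dist (\<phi> (t3 + (t2 + t1)) e) x < \<eta>"
      using e 3 \<open>w \<in> W3\<close> by (auto simp: flow_add dist_commute subset_iff)
  qed (use 1 2 3 in auto)
qed

section \<open>Separation of pseudo-orbits\<close>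

text \<open>Expansivity separates closed orbits in finite time: if two of them stay close during one
  period, even after time shifts bounded by the difference of the periods, then the linear change
  of time that matches the periods keeps them close for all times.\<close>

lemma closed_orbits_separated: "\<exists>\<epsilon>>0. separates_closed_orbits \<phi> \<epsilon>"
proof -
  from expansivity[of 1] obtain \<epsilon> where \<epsilon>: "\<epsilon> > 0"
    and ex: "\<And>x y (s :: real \<Rightarrow> real). continuous_on UNIV s \<Longrightarrow> s 0 = 0 \<Longrightarrow>
      (\<And>t. dist (\<phi> t x) (\<phi> (s t) y) \<le> \<epsilon>) \<Longrightarrow> \<exists>\<tau>\<in>{-1..1}. y = \<phi> \<tau> x"
    by (metis zero_less_one)
  have "y \<in> flow_orbit \<phi> x"
    if x: "\<phi> T x = x" and y: "\<phi> T' y = y" and T: "0 < T" "T \<le> T'"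
      and close: "\<And>s v. 0 \<le> s \<Longrightarrow> s \<le> T \<Longrightarrow> \<bar>v\<bar> \<le> T' - T \<Longrightarrow> dist (\<phi> s x) (\<phi> (s + v) y) \<le> \<epsilon>"
    for x y T T'
  proof -
    define r where "r = T' / T"
    have r: "r \<ge> 1" "r * T = T'" using T by (auto simp: r_def)
    have "dist (\<phi> t x) (\<phi> (r * t) y) \<le> \<epsilon>" for t
    proof -
      define k where "k = \<lfloor>t / T\<rfloor>"
      define u where "u = t - k * T"
      have u: "0 \<le> u" "u \<le> T"
        using floor_divide_lower[OF T(1), of t] floor_divide_upper[OF T(1), of t]
        by (simp_all add: u_def k_def algebra_simps)
      have t: "t = u + k * T" "r * t = r * u + k * T'"
        using r(2) by (auto simp: u_def algebra_simps)
      have "0 \<le> (r - 1) * u" "(r - 1) * u \<le> (r - 1) * T"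
        using r(1) u by (auto intro: mult_left_mono)
      then have "\<bar>r * u - u\<bar> \<le> T' - T" using r(2) by (simp add: algebra_simps)
      then have "dist (\<phi> u x) (\<phi> (r * u) y) \<le> \<epsilon>" using close[OF u, of "r * u - u"] by simp
      moreover have "\<phi> t x = \<phi> u x"
        unfolding t(1) by (rule flow_shift_period[OF x])
      moreover have "\<phi> (r * t) y = \<phi> (r * u) y"
        unfolding t(2) by (rule flow_shift_period[OF y])
      ultimately show ?thesis by simp
    qed
    then have "\<exists>\<tau>\<in>{-1..1}. y = \<phi> \<tau> x"
      by (intro ex[of "\<lambda>t. r * t"]) (auto intro!: continuous_intros)
    then show ?thesis by (auto simp: flow_orbit_def)
  qed
  then have "separates_closed_orbits \<phi> \<epsilon>"
    unfolding separates_closed_orbits_def by (intro allI impI; elim conjE) blast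
  with \<epsilon> show ?thesis by blast
qed

text \<open>If the excursion leaves the orbit of \<open>x\<close> at time \<open>s\<close>, the position of the excursion in a
  block can be read off any orbit that traces the block.\<close>

lemma block_position_less:
  assumes z: "traces \<phi> \<kappa> z (block x e t R n a)" and z': "traces \<phi> \<kappa> z' (block x e t R n a')"
    and close: "\<And>s. dist (\<phi> s z) (\<phi> s z') \<le> \<theta>"
    and per: "\<phi> R x = x" and s: "0 \<le> s" "s \<le> t" "t \<le> R"
    and away: "\<And>p. p \<in> flow_orbit \<phi> x \<Longrightarrow> dist (\<phi> s e) p \<ge> 2 * \<kappa> + \<theta>"
  shows "\<not> a < a'"
proof
  assume "a < a'"
  define v where "v = real a * R + s"
  have "real (Suc a) * R \<le> real a' * R" using \<open>a < a'\<close> s by (intro mult_right_mono) auto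
  then have v: "0 \<le> v" "v \<le> real a' * R" using s by (auto simp: v_def algebra_simps)
  have "dist (\<phi> s (\<phi> (real a * R) z)) (\<phi> s e) < \<kappa>" using z s by (simp add: block_def)
  then have "dist (\<phi> v z) (\<phi> s e) < \<kappa>" by (simp add: v_def add.commute[of _ s] flow_add)
  moreover have "dist (\<phi> v z') (\<phi> v x) < \<kappa>" using z' v by (simp add: block_def)
  ultimately have "dist (\<phi> s e) (\<phi> v x) < 2 * \<kappa> + \<theta>"
    using close[of v] dist_triangle[of "\<phi> s e" "\<phi> v x" "\<phi> v z"]
      dist_triangle[of "\<phi> v z" "\<phi> v x" "\<phi> v z'"] by (simp add: dist_commute)
  moreover have "\<phi> v x \<in> flow_orbit \<phi> x" by (simp add: flow_orbit_def)
  ultimately show False using away by force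
qed

lemma block_position:
  assumes z: "traces \<phi> \<kappa> z (block x e t R n a)" and z': "traces \<phi> \<kappa> z' (block x e t R n a')"
    and close: "\<And>s. dist (\<phi> s z) (\<phi> s z') \<le> \<theta>"
    and per: "\<phi> R x = x" and s: "0 \<le> s" "s \<le> t" "t \<le> R"
    and away: "\<And>p. p \<in> flow_orbit \<phi> x \<Longrightarrow> dist (\<phi> s e) p \<ge> 2 * \<kappa> + \<theta>"
  shows "a = a'"
  using block_position_less[OF z z' close per s away]
    block_position_less[OF z' z _ per s away] close
  by (metis dist_commute linorder_less_linear)

end

text \<open>Three blocks in a row, with independent positions of the excursions.\<close>

definition itinerary :: "'a \<Rightarrow> 'a \<Rightarrow> real \<Rightarrow> real \<Rightarrow> nat \<Rightarrow> nat \<times> nat \<times> nat \<Rightarrow> ('a \<times> real) list" where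
  "itinerary x e t R n a =
     block x e t R n (fst a) @ block x e t R n (fst (snd a)) @ block x e t R n (snd (snd a))"

lemma duration_itinerary:
  "a \<in> {..n} \<times> {..n} \<times> {..n} \<Longrightarrow> duration (itinerary x e t R n a) = 3 * (real n * R + t)"
  by (auto simp: itinerary_def duration_block)

context H_flow
begin

lemma traces_mono: "traces \<phi> \<kappa> z ps \<Longrightarrow> \<kappa> \<le> \<kappa>' \<Longrightarrow> traces \<phi> \<kappa>' z ps"
  by (induction ps arbitrary: z) force+

lemma itinerary_position:
  assumes z: "traces \<phi> \<kappa> z (itinerary x e t R n a)" and z': "traces \<phi> \<kappa> z' (itinerary x e t R n a')"
    and a: "a \<in> {..n} \<times> {..n} \<times> {..n}" "a' \<in> {..n} \<times> {..n} \<times> {..n}"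
    and close: "\<And>s. dist (\<phi> s z) (\<phi> s z') \<le> \<theta>"
    and per: "\<phi> R x = x" and s: "0 \<le> s" "s \<le> t" "t \<le> R"
    and away: "\<And>p. p \<in> flow_orbit \<phi> x \<Longrightarrow> dist (\<phi> s e) p \<ge> 2 * \<kappa> + \<theta>"
  shows "a = a'"
proof -
  have close': "dist (\<phi> s (\<phi> v z)) (\<phi> s (\<phi> v z')) \<le> \<theta>" for s v
    using close[of "s + v"] by (simp add: flow_add)
  obtain a1 a2 a3 where a_eq: "a = (a1, a2, a3)" by (cases a)
  obtain a1' a2' a3' where a'_eq: "a' = (a1', a2', a3')" by (cases a')
  define d where "d = real n * R + t"
  have t: "traces \<phi> \<kappa> z (block x e t R n a1)" "traces \<phi> \<kappa> z' (block x e t R n a1')"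
    "traces \<phi> \<kappa> (\<phi> d z) (block x e t R n a2)" "traces \<phi> \<kappa> (\<phi> d z') (block x e t R n a2')"
    "traces \<phi> \<kappa> (\<phi> d (\<phi> d z)) (block x e t R n a3)"
    "traces \<phi> \<kappa> (\<phi> d (\<phi> d z')) (block x e t R n a3')"
    using z z' a by (auto simp: a_eq a'_eq itinerary_def traces_append duration_block d_def)
  have "a1 = a1'" by (rule block_position[OF t(1,2) close per s away])
  moreover have "a2 = a2'" by (rule block_position[OF t(3,4) close' per s away])
  moreover have "a3 = a3'"
  proof (rule block_position[OF t(5,6) _ per s away])
    show "dist (\<phi> s (\<phi> d (\<phi> d z))) (\<phi> s (\<phi> d (\<phi> d z'))) \<le> \<theta>" for s
      using close'[of s "d + d"] by (simp only: flow_add)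
  qed
  ultimately show ?thesis by (simp add: a_eq a'_eq)
qed

section \<open>Realizing itineraries by closed orbits\<close>

text \<open>Given a closed orbit through \<open>x0\<close>, every itinerary on it, followed by a loop \<open>(x, T)\<close>
  at a point of \<open>K\<close>, is traced by a closed orbit of period in \<open>[L, L + 3\<tau>]\<close>, provided that \<open>L\<close>
  is large and leaves room for it. The excursion can be made to pass near given points \<open>q\<close> and
  \<open>y\<close>. The rest of the time is spent on the orbit of \<open>x0\<close>. The number of segments is always 13;
  this matters, because the precision \<open>\<eta>\<close> in the shadowing property depends on it. The connecting segments between \<open>x0\<close> and
  \<open>x\<close> are taken from a finite family, indexed by the centers \<open>j \<in> J\<close> of a covering of \<open>K\<close>.\<close>

lemma realize_itineraries:
  fixes K :: "'a set"
  assumes K: "compact K" and x0: "x0 \<in> K" "\<phi> \<tau> x0 = x0" "\<tau> \<ge> 1" and \<kappa>: "\<kappa> > 0" "\<kappa> \<le> 1"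
  obtains e t R s u D Lmin and J :: "'a set" and p :: "'a \<Rightarrow> 'a" and c :: "'a \<Rightarrow> real"
    where "R > 0" "\<phi> R x0 = x0" "0 \<le> s" "s \<le> t" "0 \<le> u" "u \<le> t" "t \<le> R"
    "dist q (\<phi> s e) < \<kappa>" "dist y (\<phi> u e) < \<kappa>" "finite J"
    "\<And>L n a x T. L \<ge> Lmin \<Longrightarrow> a \<in> {..n} \<times> {..n} \<times> {..n} \<Longrightarrow> x \<in> K \<Longrightarrow> \<phi> T x = x \<Longrightarrow> T \<ge> 0 \<Longrightarrow>
       3 * (real n * R) + T + D \<le> L \<Longrightarrow>
       \<exists>j\<in>J. \<exists>z S. L \<le> S \<and> S \<le> L + 3 * \<tau> \<and> \<phi> S z = z \<and>
         traces \<phi> \<kappa> z (itinerary x0 e t R n a @ [(p j, c j), (x, T)])"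
proof -
  obtain K' r where K': "compact K'" "r > 0" "\<And>x. x \<in> K \<Longrightarrow> ball x r \<subseteq> K'"
    using compact_neighbourhood[OF K] by blast
  have "\<kappa> / 2 > 0" using \<kappa> by simp
  from closing_lemma[OF this, of x0] obtain \<delta>c Lc where \<delta>c: "\<delta>c > 0"
    and cl: "\<And>y t. y \<in> ball x0 (\<kappa>/2) \<Longrightarrow> t \<ge> Lc \<Longrightarrow> dist (\<phi> t y) y \<le> \<delta>c \<Longrightarrow>
           (\<exists>z\<in>ball y (\<kappa>/2). \<exists>\<tau>\<in>{t - \<kappa>/2..t + \<kappa>/2}. \<phi> \<tau> z = z \<and>
              (\<forall>s\<in>{0..t}. dist (\<phi> s z) (\<phi> s y) \<le> \<kappa>/2))"
    by meson
  define \<delta> where "\<delta> = min (\<kappa>/2) (\<delta>c/2)"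
  have \<delta>: "\<delta> > 0" "\<delta> \<le> \<kappa>/2" "\<delta> \<le> \<delta>c/2" using \<kappa> \<delta>c by (auto simp: \<delta>_def)
  obtain \<eta>0 where \<eta>0: "\<eta>0 > 0"
    and sh: "\<And>ps. length ps = 13 \<Longrightarrow> fst ` set ps \<subseteq> K' \<Longrightarrow> \<forall>p\<in>set ps. snd p \<ge> 0 \<Longrightarrow>
       chain \<phi> \<eta>0 ps \<Longrightarrow> \<exists>y. traces \<phi> \<delta> y ps"
    by (rule shadowing_list[OF K'(1) \<delta>(1), of 13]) simp_all
  define \<eta> where "\<eta> = min \<eta>0 r"
  have \<eta>: "\<eta> > 0" "\<eta> \<le> \<eta>0" "\<eta> \<le> r" using \<eta>0 K' by (auto simp: \<eta>_def)
  have near: "x' \<in> K'" if "x \<in> K" "dist x x' < \<eta>" for x x'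
    using that K'(3)[of x] \<eta> by (auto simp: subset_iff)
  obtain e t s u where e: "dist x0 e < \<eta>" "dist (\<phi> t e) x0 < \<eta>" "0 \<le> s" "s \<le> t" "0 \<le> u" "u \<le> t"
    "dist q (\<phi> s e) < \<kappa>" "dist y (\<phi> u e) < \<kappa>"
    using excursion[OF \<eta>(1) \<kappa>(1)] by metis
  define R where "R = real (nat \<lceil>t / \<tau>\<rceil> + 1) * \<tau>"
  have "t / \<tau> \<le> real (nat \<lceil>t / \<tau>\<rceil> + 1)" by linarith
  moreover have "\<phi> R x0 = x0" unfolding R_def by (rule flow_period_nat[OF x0(2)])
  ultimately have R: "R > 0" "t \<le> R" "\<phi> R x0 = x0"
    using x0(3) by (auto simp: R_def pos_divide_le_eq)
  have R_mult: "\<phi> (real k * R) x0 = x0" for k using flow_period_nat[OF R(3)] .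
  obtain J where J: "J \<subseteq> K" "finite J" "K \<subseteq> (\<Union>j\<in>J. ball j (\<eta>/2))"
    by (rule compactE_image[OF K, of K "\<lambda>j. ball j (\<eta>/2)"]) (use \<eta>(1) in auto)
  have "\<forall>j. \<exists>p c. dist x0 p < \<eta> \<and> c \<ge> 0 \<and> dist (\<phi> c p) j < \<eta>/2"
    using connecting_segment[of \<eta> "\<eta>/2"] \<eta>(1) by (metis half_gt_zero)
  then obtain p c where pc: "\<And>j. dist x0 (p j) < \<eta>" "\<And>j. c j \<ge> 0" "\<And>j. dist (\<phi> (c j) (p j)) j < \<eta>/2"
    by metis
  have "\<forall>j. \<exists>p c. dist j p < \<eta>/2 \<and> c \<ge> 0 \<and> dist (\<phi> c p) x0 < \<eta>"
    using connecting_segment[of "\<eta>/2" \<eta>] \<eta>(1) by (metis half_gt_zero)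
  then obtain p' c' where pc': "\<And>j. dist j (p' j) < \<eta>/2" "\<And>j. c' j \<ge> 0" "\<And>j. dist (\<phi> (c' j) (p' j)) x0 < \<eta>"
    by metis
  define D where "D = 3 * t + (\<Sum>j\<in>J. c j + c' j)"
  show thesis
  proof (rule that[of R s t u e J Lc D p c])
    fix L n a x T
    assume L: "L \<ge> Lc" and a: "a \<in> {..n} \<times> {..n} \<times> {..n}" and x: "x \<in> K" "\<phi> T x = x" and T: "T \<ge> 0"
      and room: "3 * (real n * R) + T + D \<le> L"
    obtain j where j: "j \<in> J" "dist j x < \<eta>/2" using J(3) x(1) by auto
    have cj: "c j + c' j \<le> (\<Sum>j\<in>J. c j + c' j)"
      using j(1) J(2) pc(2) pc'(2) by (intro member_le_sum) auto
    \<comment> \<open>The time left over is filled by \<open>m\<close> turns on the orbit of \<open>x0\<close>. The total \<open>S\<close> lies in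
      \<open>[L + \<tau>, L + 2\<tau>]\<close>, and closing up changes it by at most \<open>\<kappa> / 2 \<le> \<tau>\<close>.\<close>
    define pre where "pre = 3 * (real n * R + t) + c j + T + c' j"
    have pre: "pre \<le> L" using room cj by (simp add: pre_def D_def)
    define m where "m = nat \<lceil>(L + \<tau> - pre) / \<tau>\<rceil>"
    have nn: "(L + \<tau> - pre) / \<tau> \<ge> 0" using pre x0 by simp
    then have "(L + \<tau> - pre) / \<tau> \<le> real m" "real m < (L + \<tau> - pre) / \<tau> + 1"
      unfolding m_def by linarith+
    then have m: "L + \<tau> \<le> pre + real m * \<tau>" "pre + real m * \<tau> \<le> L + 2 * \<tau>"
      using x0 by (auto simp: field_simps)
    define qs where "qs = itinerary x0 e t R n a @ [(p j, c j), (x, T)]"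
    define ps where "ps = qs @ [(p' j, c' j), (x0, real m * \<tau>)]"
    define S where "S = pre + real m * \<tau>"
    have S: "duration ps = S" "L + \<tau> \<le> S" "S \<le> L + 2 * \<tau>"
      using m duration_itinerary[OF a] by (auto simp: ps_def qs_def pre_def S_def)
    have x0m: "\<phi> (real m * \<tau>) x0 = x0" by (rule flow_period_nat[OF x0(2)])
    have nonneg: "snd q \<ge> 0" if "q \<in> set ps" for q
      using that pc(2)[of j] pc'(2)[of j] T x0(3) e R(1)
      by (auto simp: ps_def qs_def itinerary_def block_def)
    have "\<exists>y. traces \<phi> \<delta> y ps"
    proof (rule sh)
      show "length ps = 13" by (simp add: ps_def qs_def itinerary_def block_def)
      have "dist j (p' j) < \<eta>" using pc'(1)[of j] \<eta>(1) by linarith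
      then show "fst ` set ps \<subseteq> K'"
        using near[of x0] near[of j "p' j"] near[of x x] x0(1) x(1) e(1) pc(1)[of j] j(1) J(1) \<eta>(1)
        by (auto simp: ps_def qs_def itinerary_def block_def)
      have "dist (\<phi> (c j) (p j)) x < \<eta>"
        using pc(3)[of j] j(2) dist_triangle[of "\<phi> (c j) (p j)" x j] by linarith
      moreover have "dist x (p' j) < \<eta>"
        using pc'(1)[of j] j(2) dist_triangle3[of x "p' j" j] by linarith
      ultimately have "chain \<phi> \<eta> ps"
        using e(1,2) pc(1)[of j] pc'(3)[of j] x(2) \<eta>(1)
        by (simp add: chain_def ps_def qs_def itinerary_def block_def R_mult)
      then show "chain \<phi> \<eta>0 ps"
        unfolding chain_def by (rule successively_mono) (use \<eta>(2) in auto)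
    qed (use nonneg in blast)
    then obtain y where y: "traces \<phi> \<delta> y ps" by blast
    have "dist (\<phi> 0 y) (\<phi> 0 x0) < \<delta>"
      using y R(1) by (auto simp: ps_def qs_def itinerary_def block_def simp del: flow_0)
    then have y0: "dist x0 y < \<delta>" by (simp add: dist_commute)
    have ps_eq: "ps = (qs @ [(p' j, c' j)]) @ [(x0, real m * \<tau>)]" by (simp add: ps_def)
    have "dist (\<phi> (real m * \<tau>) (\<phi> (duration (qs @ [(p' j, c' j)])) y)) (\<phi> (real m * \<tau>) x0) < \<delta>"
      using y x0(3) unfolding ps_eq traces_append[of _ _ "qs @ [(p' j, c' j)]"] by simp
    then have yS: "dist (\<phi> S y) x0 < \<delta>"
      using S(1) x0m by (simp add: ps_eq add.commute add.left_commute flip: flow_add)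
    have "dist (\<phi> S y) y \<le> \<delta>c"
      using y0 yS \<delta>(3) dist_triangle[of "\<phi> S y" y x0] by linarith
    moreover have "y \<in> ball x0 (\<kappa>/2)" "S \<ge> Lc" using y0 \<delta>(2) S(2) L x0(3) by auto
    ultimately obtain z S' where z: "S' \<in> {S - \<kappa>/2..S + \<kappa>/2}" "\<phi> S' z = z"
      "\<forall>s\<in>{0..S}. dist (\<phi> s z) (\<phi> s y) \<le> \<kappa>/2"
      using cl by blast
    have "traces \<phi> (\<delta> + \<kappa>/2) z ps"
      using traces_perturb[OF y nonneg, of z "\<kappa>/2"] z(3) S(1) by auto
    then have "traces \<phi> \<kappa> z ps" by (rule traces_mono) (use \<delta>(2) in simp)
    then have "traces \<phi> \<kappa> z qs" by (simp add: ps_def traces_append)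
    moreover have "L \<le> S'" "S' \<le> L + 3 * \<tau>" using z(1) S \<kappa>(2) x0(3) by auto
    ultimately show "\<exists>j\<in>J. \<exists>z S. L \<le> S \<and> S \<le> L + 3 * \<tau> \<and> \<phi> S z = z \<and>
         traces \<phi> \<kappa> z (itinerary x0 e t R n a @ [(p j, c j), (x, T)])"
      using z(2) j(1) unfolding qs_def by blast
  qed (use R e J pc in auto)
qed

section \<open>Non-primitive orbits are rare\<close>

text \<open>An orbit that is not primitive has a period that is at most half of the given one.\<close>

lemma non_primitive_half_period:
  assumes "\<gamma> \<in> PK \<phi> K L L' - PK_prim \<phi> K L L'"
  obtains x T where "x \<in> fst \<gamma>" "x \<in> K" "\<phi> T x = x" "0 < T" "T \<le> snd \<gamma> / 2"
proof -
  have \<gamma>: "\<gamma> \<in> periodic_orbits \<phi>" "\<gamma> \<notin> primitive_orbits \<phi>" "fst \<gamma> \<inter> K \<noteq> {}"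
    using assms by (auto simp: PK_def PK_prim_def)
  then obtain x where x: "x \<in> fst \<gamma>" "x \<in> K" by blast
  note px = periodic_orbitsD[OF \<gamma>(1) x(1)]
  have "\<exists>t\<in>{0<..<snd \<gamma>}. \<phi> t x = x"
  proof (rule ccontr)
    assume "\<not> ?thesis"
    then have "(flow_orbit \<phi> x, snd \<gamma>) \<in> primitive_orbits \<phi>"
      using px unfolding primitive_orbits_def by blast
    then show False using \<gamma>(2) px(1) by (metis prod.collapse)
  qed
  then obtain t where t: "0 < t" "t < snd \<gamma>" "\<phi> t x = x" by auto
  have "\<phi> (snd \<gamma> - t) x = \<phi> (snd \<gamma>) (\<phi> (- t) x)" by (simp flip: flow_add)
  then have "\<phi> (snd \<gamma> - t) x = x" using px(2) flow_period_minus[OF t(3)] by simp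
  then show thesis
    using that[OF x, of t] that[OF x, of "snd \<gamma> - t"] t by (cases "t \<le> snd \<gamma> / 2") auto
qed

lemma orbit_away:
  assumes "\<phi> T x = x" "T > 0" "q \<notin> flow_orbit \<phi> x"
  obtains d where "d > 0" "\<And>p. p \<in> flow_orbit \<phi> x \<Longrightarrow> dist q p \<ge> d"
proof -
  have "flow_orbit \<phi> x = (\<lambda>t. \<phi> t x) ` {0..T}"
  proof
    show "flow_orbit \<phi> x \<subseteq> (\<lambda>t. \<phi> t x) ` {0..T}"
    proof
      fix y assume "y \<in> flow_orbit \<phi> x"
      then obtain t where t: "y = \<phi> t x" by (auto simp: flow_orbit_def)
      obtain u where "0 \<le> u" "u < T" "\<phi> u x = \<phi> t x" using flow_reduce[OF assms(1,2)] by metis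
      then show "y \<in> (\<lambda>t. \<phi> t x) ` {0..T}" using t by (intro image_eqI[of _ _ u]) auto
    qed
  qed (auto simp: flow_orbit_def)
  moreover have "compact ((\<lambda>t. \<phi> t x) ` {0..T})"
    by (intro compact_continuous_image continuous_on_subset[OF continuous_flow_time]) auto
  ultimately have "open (- flow_orbit \<phi> x)" using compact_imp_closed by (metis open_Compl)
  then obtain d where "d > 0" "ball q d \<subseteq> - flow_orbit \<phi> x"
    using assms(3) by (meson ComplI open_contains_ball)
  then show thesis by (intro that[of d]) (auto simp: subset_iff not_less[symmetric])
qed

text \<open>An itinerary with a loop \<open>(x, T)\<close> attached to it is determined by a point whose orbit
  traces it, once \<open>T\<close> is known up to a small error; the loop is determined as a set. It is
  enough to know the point up to passing to another one whose orbit stays \<open>\<theta>\<close>-close.\<close>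

lemma recover_itinerary:
  assumes sep: "separates_closed_orbits \<phi> \<epsilon>"
    and z: "traces \<phi> \<kappa> z (itinerary x0 e t R n a @ [(p, c), (x, T)])"
    and z': "traces \<phi> \<kappa> z' (itinerary x0 e t R n a' @ [(p, c), (x', T')])"
    and a: "a \<in> {..n} \<times> {..n} \<times> {..n}" "a' \<in> {..n} \<times> {..n} \<times> {..n}"
    and close: "\<And>s. dist (\<phi> s z) (\<phi> s z') \<le> \<theta>"
    and per: "\<phi> R x0 = x0" and s: "0 \<le> s" "s \<le> t" "t \<le> R"
    and away: "\<And>p. p \<in> flow_orbit \<phi> x0 \<Longrightarrow> dist (\<phi> s e) p \<ge> 2 * \<kappa> + \<theta>"
    and x: "\<phi> T x = x" "0 < T" and x': "\<phi> T' x' = x'" "0 < T'"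
    and b: "\<And>x s t. dist (\<phi> s x) (\<phi> t x) \<le> b * \<bar>s - t\<bar>" "b \<ge> 0" "b * \<bar>T - T'\<bar> \<le> \<theta>"
    and small: "2 * \<kappa> + 2 * \<theta> \<le> \<epsilon>"
  shows "a = a'" "flow_orbit \<phi> x = flow_orbit \<phi> x'"
proof -
  show "a = a'"
    by (rule itinerary_position[OF _ _ a close per s away]) (use z z' in \<open>auto simp: traces_append\<close>)
  define d where "d = 3 * (real n * R + t)"
  have w: "traces \<phi> \<kappa> (\<phi> c (\<phi> d z)) [(x, T)]" "traces \<phi> \<kappa> (\<phi> c (\<phi> d z')) [(x', T')]"
    using z z' a by (simp_all add: traces_append duration_itinerary d_def)
  have near: "dist (\<phi> v x) (\<phi> v x') \<le> 2 * \<kappa> + \<theta>" if "0 \<le> v" "v \<le> T" "v \<le> T'" for v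
  proof -
    have "dist (\<phi> v (\<phi> c (\<phi> d z))) (\<phi> v x) < \<kappa>" "dist (\<phi> v (\<phi> c (\<phi> d z'))) (\<phi> v x') < \<kappa>"
      using w that by auto
    moreover have "dist (\<phi> v (\<phi> c (\<phi> d z))) (\<phi> v (\<phi> c (\<phi> d z'))) \<le> \<theta>"
      using close[of "v + (c + d)"] by (simp only: flow_add)
    ultimately show ?thesis
      using dist_triangle[of "\<phi> v x" "\<phi> v x'" "\<phi> v (\<phi> c (\<phi> d z))"]
        dist_triangle[of "\<phi> v (\<phi> c (\<phi> d z))" "\<phi> v x'" "\<phi> v (\<phi> c (\<phi> d z'))"]
      by (simp add: dist_commute)
  qed
  have shifted: "dist (\<phi> r y) (\<phi> (r + v) y') \<le> \<epsilon>"
    if "dist (\<phi> r y) (\<phi> r y') \<le> 2 * \<kappa> + \<theta>" "\<bar>v\<bar> \<le> \<bar>T - T'\<bar>" for r v y y'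
  proof -
    have "dist (\<phi> r y') (\<phi> (r + v) y') \<le> b * \<bar>r - (r + v)\<bar>" by (rule b(1))
    also have "\<dots> \<le> b * \<bar>T - T'\<bar>" using that(2) b(2) by (intro mult_left_mono) auto
    finally show ?thesis
      using that(1) b(3) small dist_triangle[of "\<phi> r y" "\<phi> (r + v) y'" "\<phi> r y'"] by linarith
  qed
  have "x' \<in> flow_orbit \<phi> x \<or> x \<in> flow_orbit \<phi> x'"
  proof (cases "T \<le> T'")
    case True
    then have "x' \<in> flow_orbit \<phi> x"
      using x x' near by (intro sep[unfolded separates_closed_orbits_def, rule_format, of T x T' x'])
        (auto intro!: shifted)
    then show ?thesis ..
  next
    case False
    then have "x \<in> flow_orbit \<phi> x'"
      using x x' near by (intro sep[unfolded separates_closed_orbits_def, rule_format, of T' x' T x])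
        (auto intro!: shifted simp: dist_commute)
    then show ?thesis ..
  qed
  then show "flow_orbit \<phi> x = flow_orbit \<phi> x'" using flow_orbit_eq by metis
qed

text \<open>A non-primitive orbit \<open>\<gamma>\<close> of period about \<open>L\<close> runs several times along a loop of at
  most half its length. The loop is combined with each of the \<open>(n + 1)\<^sup>3\<close> itineraries, where \<open>n\<close>
  is of the order of \<open>L\<close>, and the result is realized by a closed orbit that also has period about
  \<open>L\<close>. This orbit, together with \<open>O(L\<^sup>2)\<close>
  many values of auxiliary data, determines \<open>\<gamma>\<close> and the itinerary. Hence, if the orbits in the
  window are finite in number, the non-primitive ones form a fraction \<open>O(1 / L)\<close>.\<close>

lemma non_primitive_rare:
  fixes K :: "'a set"
  defines "\<tau> \<equiv> tauK \<phi> K"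
  assumes K: "compact K" "interior K \<noteq> {}" and orig: "origin_choice \<phi> orig"
    and not_single: "\<And>x T. \<phi> T x = x \<Longrightarrow> T > 0 \<Longrightarrow> flow_orbit \<phi> x \<noteq> UNIV"
  shows "\<exists>C>0. \<exists>L0. \<forall>L\<ge>L0. finite (PK \<phi> K L (L + 5 * \<tau>)) \<longrightarrow>
       real (card (PK \<phi> K L (L + 5 * \<tau>) - PK_prim \<phi> K L (L + 5 * \<tau>))) * L
         \<le> C * real (card (PK \<phi> K L (L + 5 * \<tau>)))"
proof -
  obtain x0 where x0: "x0 \<in> K" "\<phi> \<tau> x0 = x0" "\<tau> \<ge> 1"
    using tauK_attained[OF K] unfolding \<tau>_def by blast
  obtain q where "q \<notin> flow_orbit \<phi> x0" using not_single[OF x0(2)] x0(3) by auto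
  then obtain d where d: "d > 0" "\<And>p. p \<in> flow_orbit \<phi> x0 \<Longrightarrow> dist q p \<ge> d"
    using orbit_away[OF x0(2)] x0(3) by (metis less_le_trans zero_less_one)
  obtain y r where y: "r > 0" "ball y r \<subseteq> K" using K(2) by (meson all_not_in_conv mem_interior)
  obtain p\<^sub>0 where p0: "p\<^sub>0 > 0" "\<And>x T. x \<in> K \<Longrightarrow> T > 0 \<Longrightarrow> \<phi> T x = x \<Longrightarrow> T \<ge> p\<^sub>0"
    using periods_bounded_below[OF K(1)] by blast
  obtain b where b: "b > 0" "\<And>x s t. dist (\<phi> s x) (\<phi> t x) \<le> b * \<bar>s - t\<bar>"
    using speed_bound by blast
  obtain \<epsilon> where \<epsilon>: "\<epsilon> > 0" and sep: "separates_closed_orbits \<phi> \<epsilon>"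
    using closed_orbits_separated by blast
  define \<kappa> where "\<kappa> = min (min 1 (r / 2)) (min (d / 4) (\<epsilon> / 4))"
  have \<kappa>: "\<kappa> > 0" "\<kappa> \<le> 1" "2 * \<kappa> \<le> r" "4 * \<kappa> \<le> d" "4 * \<kappa> \<le> \<epsilon>"
    using y(1) d(1) \<epsilon> by (auto simp: \<kappa>_def)
  define \<sigma> where "\<sigma> = min p\<^sub>0 (\<kappa> / b)"
  have "b * \<sigma> \<le> b * (\<kappa> / b)" using b(1) by (intro mult_left_mono) (auto simp: \<sigma>_def)
  then have \<sigma>: "\<sigma> > 0" "\<sigma> \<le> p\<^sub>0" "b * \<sigma> \<le> \<kappa>"
    using p0(1) \<kappa>(1) b(1) by (simp_all add: \<sigma>_def)
  obtain e t R s u D Lmin J p c where R: "R > 0" "\<phi> R x0 = x0" "0 \<le> s" "s \<le> t" "0 \<le> u" "u \<le> t" "t \<le> R"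
    and e: "dist q (\<phi> s e) < \<kappa>" "dist y (\<phi> u e) < \<kappa>" and J: "finite (J :: 'a set)"
    and realize: "\<And>L n a x T. L \<ge> Lmin \<Longrightarrow> a \<in> {..n} \<times> {..n} \<times> {..n} \<Longrightarrow> x \<in> K \<Longrightarrow> \<phi> T x = x \<Longrightarrow> T \<ge> 0 \<Longrightarrow>
       3 * (real n * R) + T + D \<le> L \<Longrightarrow>
       \<exists>j\<in>J. \<exists>z S. L \<le> S \<and> S \<le> L + 3 * \<tau> \<and> \<phi> S z = z \<and>
         traces \<phi> \<kappa> z (itinerary x0 e t R n a @ [(p j, c j), (x, T)])"
    by (rule realize_itineraries[OF K(1) x0 \<kappa>(1,2), of q y]) (rule that, assumption+)
  have away: "dist (\<phi> s e) p' \<ge> 2 * \<kappa> + \<kappa>" if "p' \<in> flow_orbit \<phi> x0" for p'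
    using d(2)[OF that] e(1) \<kappa>(4) dist_triangle[of q p' "\<phi> s e"] by linarith
  define MT where "MT = nat \<lfloor>5 * \<tau> / \<sigma>\<rfloor>"
  define L0 where "L0 = max (max Lmin (10 * \<tau> + 4 * D)) (max 1 (5 * \<tau> + \<sigma>))"
  define C where "C = (12 * R) ^ 3 * (4 / \<sigma>\<^sup>2 * real (MT + 1) * real (card J + 1))"
  have "C > 0" using R(1) \<sigma>(1) unfolding C_def by (intro mult_pos_pos) auto
  moreover have "real (card (PK \<phi> K L (L + 5 * \<tau>) - PK_prim \<phi> K L (L + 5 * \<tau>))) * L
         \<le> C * real (card (PK \<phi> K L (L + 5 * \<tau>)))"
    if "L \<ge> L0" and fin: "finite (PK \<phi> K L (L + 5 * \<tau>))" for L
  proof -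
    have L: "L \<ge> Lmin" "L \<ge> 10 * \<tau> + 4 * D" "L \<ge> 1" "L \<ge> 5 * \<tau> + \<sigma>"
      using \<open>L \<ge> L0\<close> by (auto simp: L0_def)
    define P where "P = PK \<phi> K L (L + 5 * \<tau>)"
    define NP where "NP = P - PK_prim \<phi> K L (L + 5 * \<tau>)"
    \<comment> \<open>The three blocks take about a quarter of \<open>L\<close>, the loop at most about half of it.\<close>
    define n where "n = nat \<lfloor>L / (12 * R)\<rfloor>"
    have "L / (12 * R) \<ge> 0" using L(3) R(1) by simp
    then have "real n \<le> L / (12 * R)" "L / (12 * R) \<le> real n + 1" unfolding n_def by linarith+
    then have n: "12 * (real n * R) \<le> L" "L \<le> 12 * R * (real n + 1)"
      using R(1) by (auto simp: field_simps)
    define M where "M = nat \<lfloor>(L + 5 * \<tau>) / \<sigma>\<rfloor>"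
    define A where "A = {..n} \<times> {..n} \<times> {..n}"
    define V where "V = P \<times> {..M} \<times> {..M} \<times> {..MT} \<times> J"
    \<comment> \<open>A code \<open>(\<gamma>', cu, c1, cT, j)\<close> of \<open>(\<gamma>, a)\<close>: a closed orbit \<open>\<gamma>'\<close> that traces the itinerary
      \<open>a\<close> with a loop on \<open>\<gamma>\<close>, the cells of length \<open>\<sigma>\<close> that contain the phase on \<open>\<gamma>'\<close>, the period of
      the loop and the period of \<open>\<gamma>\<close>, and the index of the connecting segments.\<close>
    define codes where "codes = (\<lambda>(\<gamma>, a) (\<gamma>', cu, c1, cT, j). \<exists>v x T.
        0 \<le> v \<and> cu = nat \<lfloor>v / \<sigma>\<rfloor> \<and> x \<in> fst \<gamma> \<and> \<phi> T x = x \<and> 0 < T \<and> c1 = nat \<lfloor>T / \<sigma>\<rfloor> \<and>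
        cT = nat \<lfloor>(snd \<gamma> - L) / \<sigma>\<rfloor> \<and>
        traces \<phi> \<kappa> (\<phi> v (orig \<gamma>')) (itinerary x0 e t R n a @ [(p j, c j), (x, T)]))"
    have "card (NP \<times> A) \<le> card V"
    proof (rule card_le_if_inj_on_rel[where r = codes])
      show "finite V" using fin J by (simp add: V_def P_def)
    next
      fix \<gamma>a assume "\<gamma>a \<in> NP \<times> A"
      then obtain \<gamma> a where \<gamma>a: "\<gamma>a = (\<gamma>, a)" "\<gamma> \<in> NP" "a \<in> A" by blast
      then obtain x T where x: "x \<in> fst \<gamma>" "x \<in> K" "\<phi> T x = x" "0 < T" "T \<le> snd \<gamma> / 2"
        using non_primitive_half_period unfolding NP_def P_def by metis
      have \<gamma>: "L \<le> snd \<gamma>" "snd \<gamma> \<le> L + 5 * \<tau>" using \<gamma>a(2) by (auto simp: NP_def P_def PK_def)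
      have a: "a \<in> {..n} \<times> {..n} \<times> {..n}" using \<gamma>a(3) by (simp add: A_def)
      have room: "3 * (real n * R) + T + D \<le> L" using n(1) x(5) \<gamma>(2) L(2) by linarith
      obtain j z S where j: "j \<in> J" and S: "L \<le> S" "S \<le> L + 3 * \<tau>" "\<phi> S z = z"
        and tr: "traces \<phi> \<kappa> z (itinerary x0 e t R n a @ [(p j, c j), (x, T)])"
        using realize[OF L(1) a x(2,3) _ room] x(4) by fastforce
      define \<gamma>' where "\<gamma>' = (flow_orbit \<phi> z, S)"
      have per: "\<gamma>' \<in> periodic_orbits \<phi>"
        using S L(3) unfolding periodic_orbits_def \<gamma>'_def by force
      \<comment> \<open>The excursion takes the tracing orbit into \<open>K\<close>.\<close>
      obtain a1 where "traces \<phi> \<kappa> z (block x0 e t R n a1)"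
        using tr by (auto simp: traces_append itinerary_def)
      then have "dist (\<phi> u (\<phi> (real a1 * R) z)) (\<phi> u e) < \<kappa>" using R by (simp add: block_def)
      then have "dist y (\<phi> u (\<phi> (real a1 * R) z)) < r"
        using e(2) \<kappa>(3) dist_triangle2[of y "\<phi> u (\<phi> (real a1 * R) z)" "\<phi> u e"] by linarith
      then have "\<phi> u (\<phi> (real a1 * R) z) \<in> K" using y(2) by auto
      moreover have "\<phi> u (\<phi> (real a1 * R) z) \<in> flow_orbit \<phi> z"
        by (auto simp: flow_orbit_def simp flip: flow_add)
      ultimately have P: "\<gamma>' \<in> P" using per S x0(3) by (auto simp: P_def PK_def \<gamma>'_def)
      have o: "orig \<gamma>' \<in> fst \<gamma>'" using orig per by (auto simp: origin_choice_def)
      have "z \<in> flow_orbit \<phi> (orig \<gamma>')"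
        using periodic_orbitsD(1)[OF per o] flow_orbit_self[of z] by (simp add: \<gamma>'_def)
      then obtain v' where "z = \<phi> v' (orig \<gamma>')" by (auto simp: flow_orbit_def)
      moreover have "\<phi> S (orig \<gamma>') = orig \<gamma>'" using periodic_orbitsD(2)[OF per o] by (simp add: \<gamma>'_def)
      ultimately obtain v where v: "0 \<le> v" "v < S" "z = \<phi> v (orig \<gamma>')"
        using flow_reduce[of S "orig \<gamma>'" v'] S(1) L(3) by (metis less_le_trans zero_less_one order.trans)
      let ?code = "(\<gamma>', nat \<lfloor>v / \<sigma>\<rfloor>, nat \<lfloor>T / \<sigma>\<rfloor>, nat \<lfloor>(snd \<gamma> - L) / \<sigma>\<rfloor>, j)"
      have "codes \<gamma>a ?code"
        unfolding codes_def \<gamma>a(1) using v x tr by auto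
      moreover have "v \<le> L + 5 * \<tau>" "T \<le> L + 5 * \<tau>" "snd \<gamma> - L \<le> 5 * \<tau>"
        using v S x \<gamma> x0(3) by linarith+
      then have "?code \<in> V"
        using P j \<sigma>(1) unfolding V_def M_def MT_def
        by (auto intro!: nat_mono floor_mono divide_right_mono)
      ultimately show "\<exists>k. k \<in> V \<and> codes \<gamma>a k" by blast
    next
      fix \<gamma>a \<gamma>a' k assume mem: "\<gamma>a \<in> NP \<times> A" "\<gamma>a' \<in> NP \<times> A" and kV: "k \<in> V"
        and codes: "codes \<gamma>a k" "codes \<gamma>a' k"
      obtain \<gamma> a where \<gamma>: "\<gamma>a = (\<gamma>, a)" "\<gamma> \<in> NP" "a \<in> A" using mem(1) by blast
      obtain \<gamma>' a' where \<gamma>': "\<gamma>a' = (\<gamma>', a')" "\<gamma>' \<in> NP" "a' \<in> A" using mem(2) by blast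
      obtain \<beta> cu c1 cT j where k: "k = (\<beta>, cu, c1, cT, j)" by (cases k)
      obtain v x T where 1: "0 \<le> v" "cu = nat \<lfloor>v / \<sigma>\<rfloor>" "x \<in> fst \<gamma>" "\<phi> T x = x" "0 < T"
        "c1 = nat \<lfloor>T / \<sigma>\<rfloor>" "cT = nat \<lfloor>(snd \<gamma> - L) / \<sigma>\<rfloor>"
        "traces \<phi> \<kappa> (\<phi> v (orig \<beta>)) (itinerary x0 e t R n a @ [(p j, c j), (x, T)])"
        using codes(1) unfolding codes_def k \<gamma>(1) by auto
      obtain v' x' T' where 2: "0 \<le> v'" "cu = nat \<lfloor>v' / \<sigma>\<rfloor>" "x' \<in> fst \<gamma>'" "\<phi> T' x' = x'" "0 < T'"
        "c1 = nat \<lfloor>T' / \<sigma>\<rfloor>" "cT = nat \<lfloor>(snd \<gamma>' - L) / \<sigma>\<rfloor>"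
        "traces \<phi> \<kappa> (\<phi> v' (orig \<beta>)) (itinerary x0 e t R n a' @ [(p j, c j), (x', T')])"
        using codes(2) unfolding codes_def k \<gamma>'(1) by auto
      have per: "\<gamma> \<in> periodic_orbits \<phi>" "\<gamma>' \<in> periodic_orbits \<phi>" "L \<le> snd \<gamma>" "L \<le> snd \<gamma>'" "fst \<gamma> \<inter> K \<noteq> {}"
        using \<gamma>(2) \<gamma>'(2) by (auto simp: NP_def P_def PK_def)
      have "\<bar>v - v'\<bar> < \<sigma>"
        using same_cell_close[OF \<sigma>(1) 1(1) 2(1)] 1(2) 2(2) by simp
      moreover have "\<bar>T - T'\<bar> < \<sigma>"
        using same_cell_close[OF \<sigma>(1), of T T'] 1(5,6) 2(5,6) by simp
      moreover have "\<bar>(snd \<gamma> - L) - (snd \<gamma>' - L)\<bar> < \<sigma>"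
        using same_cell_close[OF \<sigma>(1), of "snd \<gamma> - L" "snd \<gamma>' - L"] 1(7) 2(7) per(3,4) by simp
      ultimately have cl: "b * \<bar>v - v'\<bar> \<le> \<kappa>" "b * \<bar>T - T'\<bar> \<le> \<kappa>" "\<bar>snd \<gamma> - snd \<gamma>'\<bar> < \<sigma>"
        using b(1) \<sigma>(3) mult_left_mono[of "\<bar>v - v'\<bar>" \<sigma> b] mult_left_mono[of "\<bar>T - T'\<bar>" \<sigma> b]
        by linarith+
      have close: "dist (\<phi> w (\<phi> v (orig \<beta>))) (\<phi> w (\<phi> v' (orig \<beta>))) \<le> \<kappa>" for w
        using b(2)[of "w + v" "orig \<beta>" "w + v'"] cl(1) by (simp add: flow_add)
      have "2 * \<kappa> + 2 * \<kappa> \<le> \<epsilon>" using \<kappa>(5) by simp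
      then have eq: "a = a'" "flow_orbit \<phi> x = flow_orbit \<phi> x'"
        using recover_itinerary[OF sep 1(8) 2(8) \<gamma>(3)[unfolded A_def] \<gamma>'(3)[unfolded A_def] close
          R(2,3,4,7) away 1(4,5) 2(4,5) b(2) less_imp_le[OF b(1)] cl(2)] by blast+
      have fst_eq: "fst \<gamma> = fst \<gamma>'"
        using eq(2) periodic_orbitsD(1)[OF per(1) 1(3)] periodic_orbitsD(1)[OF per(2) 2(3)] by simp
      \<comment> \<open>The difference of two periods of one orbit is a period, hence 0 or at least \<open>p\<^sub>0\<close>.\<close>
      obtain m where m: "m \<in> fst \<gamma>" "m \<in> K" using per(5) by blast
      have "\<phi> (snd \<gamma>) m = m" "\<phi> (snd \<gamma>') m = m"
        using periodic_orbitsD(2)[OF per(1) m(1)] periodic_orbitsD(2)[OF per(2), of m] m fst_eq by auto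
      then have "\<phi> (snd \<gamma> - snd \<gamma>') m = m" "\<phi> (snd \<gamma>' - snd \<gamma>) m = m"
        using flow_add[of "snd \<gamma>" "- snd \<gamma>'" m] flow_add[of "snd \<gamma>'" "- snd \<gamma>" m]
        by (simp_all add: flow_period_minus)
      then have "snd \<gamma> = snd \<gamma>'"
        using p0(2)[OF m(2), of "snd \<gamma> - snd \<gamma>'"] p0(2)[OF m(2), of "snd \<gamma>' - snd \<gamma>"] cl(3) \<sigma>(2)
        by linarith
      then show "\<gamma>a = \<gamma>a'" using fst_eq eq(1) \<gamma>(1) \<gamma>'(1) by (simp add: prod_eq_iff)
    qed
    then have "card NP * (n + 1) ^ 3 \<le> card P * ((M + 1)\<^sup>2 * (MT + 1) * card J)"
      by (simp add: A_def V_def card_cartesian_product power3_eq_cube power2_eq_square algebra_simps)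
    then have "real (card NP * (n + 1) ^ 3) \<le> real (card P * ((M + 1)\<^sup>2 * (MT + 1) * card J))"
      by (rule of_nat_mono)
    then have le1: "real (card NP) * (real n + 1) ^ 3
        \<le> real (card P) * ((real M + 1)\<^sup>2 * (real (MT + 1) * real (card J)))"
      by (simp add: algebra_simps)
    have "(L + 5 * \<tau>) / \<sigma> \<ge> 0" using L(3) x0(3) \<sigma>(1) by simp
    then have "real M \<le> (L + 5 * \<tau>) / \<sigma>" unfolding M_def by linarith
    also have "\<dots> = (L + 5 * \<tau> + \<sigma>) / \<sigma> - 1" using \<sigma>(1) by (simp add: add_divide_distrib)
    also have "\<dots> \<le> 2 * L / \<sigma> - 1" using L(4) \<sigma>(1) by (intro diff_mono divide_right_mono) auto
    finally have "(real M + 1)\<^sup>2 \<le> (2 * L / \<sigma>)\<^sup>2" by (intro power_mono) auto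
    then have le2: "(real M + 1)\<^sup>2 * (real (MT + 1) * real (card J))
        \<le> (2 * L / \<sigma>)\<^sup>2 * (real (MT + 1) * real (card J + 1))"
      by (intro mult_mono) auto
    have "L ^ 3 \<le> (12 * R * (real n + 1)) ^ 3" using n(2) L(3) by (intro power_mono) auto
    then have "real (card NP) * L ^ 3 \<le> real (card NP) * (12 * R * (real n + 1)) ^ 3"
      by (intro mult_left_mono) auto
    also have "\<dots> = (12 * R) ^ 3 * (real (card NP) * (real n + 1) ^ 3)"
      by (simp add: power_mult_distrib)
    also have "\<dots> \<le> (12 * R) ^ 3 * (real (card P) * ((2 * L / \<sigma>)\<^sup>2 * (real (MT + 1) * real (card J + 1))))"
      using R(1) by (intro mult_left_mono order.trans[OF le1] le2) auto
    also have "\<dots> = C * real (card P) * L\<^sup>2"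
      by (simp add: C_def power_mult_distrib power_divide)
    finally have "(real (card NP) * L) * L\<^sup>2 \<le> (C * real (card P)) * L\<^sup>2"
      by (simp add: power3_eq_cube power2_eq_square mult.assoc)
    then have "real (card NP) * L \<le> C * real (card P)"
      by (rule mult_right_le_imp_le) (use L(3) in simp)
    then show ?thesis by (simp add: NP_def P_def)
  qed
  ultimately show ?thesis by blast
qed

end

section \<open>Sampling along an arithmetic progression\<close>

lemma measure_translate:
  fixes X :: "real set"
  assumes "X \<in> sets borel"
  shows "measure lborel ((+) c -` X) = measure lborel X"
proof -
  have "measure lborel X = measure (distr lborel borel ((+) c)) X" by (simp add: lborel_distr_plus)
  also have "\<dots> = measure lborel ((+) c -` X)" using assms by (subst measure_distr) auto
  finally show ?thesis by simp
qed

text \<open>Integrating over \<open>s \<in> [0, T]\<close> the number of visits of \<open>B\<close> at the times \<open>s + i T\<close> gives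
  the measure of \<open>B \<inter> [0, n T]\<close>, so that some \<open>s\<close> reaches the average.\<close>

lemma sampling:
  fixes B :: "real set"
  assumes B: "B \<in> sets borel" and T: "T > 0" and l: "real n * T \<le> l"
    and c: "c * T < measure lborel ({0..l} \<inter> B) - (l - real n * T)"
  shows "\<exists>s\<in>{0..T}. real (card {i \<in> {0..<n}. s + real i * T \<in> B}) \<ge> c"
proof (rule ccontr)
  assume "\<not> ?thesis"
  then have less: "real (card {i \<in> {0..<n}. s + real i * T \<in> B}) < c" if "s \<in> {0..T}" for s
    using that by force
  define F where "F i = {0..T} \<inter> {s. s + real i * T \<in> B}" for i
  have F: "F i \<in> sets borel" for i
  proof -
    have "{s. s + real i * T \<in> B} = (\<lambda>s. s + real i * T) -` B \<inter> space borel" by auto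
    also have "\<dots> \<in> sets borel" by (rule measurable_sets[OF _ B]) simp
    finally show ?thesis by (auto simp: F_def)
  qed
  have Ffin: "emeasure lborel (F i) < \<infinity>" for i
    by (rule le_less_trans[OF emeasure_mono[of _ "{0..T}"]]) (auto simp: F_def emeasure_lborel_Icc_eq)
  have int: "integrable lborel (\<lambda>s. indicat_real (F i) s)" for i
    using F Ffin by (intro integrable_real_indicator) auto
  have F_meas: "measure lborel (F i) = measure lborel ({real i * T..real i * T + T} \<inter> B)" for i
  proof -
    have "F i = (+) (real i * T) -` ({real i * T..real i * T + T} \<inter> B)"
      by (auto simp: F_def add.commute)
    then show ?thesis using B by (simp add: measure_translate del: vimage_Int)
  qed
  have "{0..l} \<inter> B \<subseteq> (\<Union>i\<in>{0..<n}. {real i * T..real i * T + T} \<inter> B) \<union> {real n * T..l}"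
  proof
    fix s assume s: "s \<in> {0..l} \<inter> B"
    show "s \<in> (\<Union>i\<in>{0..<n}. {real i * T..real i * T + T} \<inter> B) \<union> {real n * T..l}"
    proof (cases "s < real n * T")
      case True
      define i where "i = nat \<lfloor>s / T\<rfloor>"
      have "s / T \<ge> 0" "s / T < real n" using s T True by (auto simp: field_simps)
      then have "real i \<le> s / T" "s / T \<le> real i + 1" "real i < real n" unfolding i_def by linarith+
      then have "s \<in> {real i * T..real i * T + T}" "i \<in> {0..<n}" using T by (auto simp: field_simps)
      then show ?thesis using s by blast
    qed (use s in auto)
  qed
  moreover have "(\<Union>i\<in>{0..<n}. {real i * T..real i * T + T} \<inter> B) \<union> {real n * T..l} \<in> fmeasurable lborel"
    using B by (intro fmeasurable.Un fmeasurable.finite_UN fmeasurable_Int_fmeasurable)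
      (auto simp: fmeasurable_def emeasure_lborel_Icc_eq)
  ultimately have "measure lborel ({0..l} \<inter> B)
      \<le> measure lborel ((\<Union>i\<in>{0..<n}. {real i * T..real i * T + T} \<inter> B) \<union> {real n * T..l})"
    using B by (intro measure_mono_fmeasurable) auto
  also have "\<dots> \<le> measure lborel (\<Union>i\<in>{0..<n}. {real i * T..real i * T + T} \<inter> B) + measure lborel {real n * T..l}"
    using B by (intro measure_Un_le) auto
  also have "\<dots> \<le> (\<Sum>i\<in>{0..<n}. measure lborel (F i)) + (l - real n * T)"
    unfolding F_meas using B l by (intro add_mono measure_UNION_le) auto
  also have "(\<Sum>i\<in>{0..<n}. measure lborel (F i)) = (\<integral>s. (\<Sum>i\<in>{0..<n}. indicat_real (F i) s) \<partial>lborel)"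
    using int F by (subst Bochner_Integration.integral_sum) auto
  also have "\<dots> \<le> (\<integral>s. c * indicat_real {0..T} s \<partial>lborel)"
  proof (rule integral_mono)
    show "integrable lborel (\<lambda>s. \<Sum>i\<in>{0..<n}. indicat_real (F i) s)"
      using int by (intro Bochner_Integration.integrable_sum)
    show "integrable lborel (\<lambda>s. c * indicat_real {0..T} s)"
      by (intro integrable_mult_right integrable_real_indicator) (auto simp: emeasure_lborel_Icc_eq)
    fix s
    show "(\<Sum>i\<in>{0..<n}. indicat_real (F i) s) \<le> c * indicat_real {0..T} s"
    proof (cases "s \<in> {0..T}")
      case True
      then have "(\<Sum>i\<in>{0..<n}. indicat_real (F i) s) = (\<Sum>i\<in>{0..<n}. of_bool (s + real i * T \<in> B))"
        by (intro sum.cong) (auto simp: F_def indicator_def)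
      also have "\<dots> = real (card {i \<in> {0..<n}. s + real i * T \<in> B})"
        by (simp add: Int_def)
      finally show ?thesis using less[OF True] True by simp
    qed (auto simp: F_def)
  qed
  also have "\<dots> = c * T" using T by simp
  finally show False using c by simp
qed

section \<open>The main estimate\<close>

lemma (in H_flow) orbit_measure_eq:
  assumes "snd \<gamma> > 0" "A \<in> sets borel"
  shows "param \<phi> orig \<gamma> -` A \<in> sets borel"
    "measure (orbit_measure \<phi> orig \<gamma>) A = measure lborel ({0..snd \<gamma>} \<inter> param \<phi> orig \<gamma> -` A) / snd \<gamma>"
proof -
  have "continuous_on UNIV (param \<phi> orig \<gamma>)"
    using continuous_flow_time[of "orig \<gamma>"] by (simp add: param_def[abs_def])
  then have meas: "param \<phi> orig \<gamma> \<in> borel_measurable borel" by (rule borel_measurable_continuous_onI)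
  show B: "param \<phi> orig \<gamma> -` A \<in> sets borel"
    using measurable_sets[OF meas assms(2)] by simp
  have "measure (orbit_measure \<phi> orig \<gamma>) A
      = measure (uniform_measure lborel {0..snd \<gamma>}) (param \<phi> orig \<gamma> -` A)"
    unfolding orbit_measure_def using assms(2) meas
    by (subst measure_distr) (auto simp: measurable_def)
  also have "\<dots> = measure lborel ({0..snd \<gamma>} \<inter> param \<phi> orig \<gamma> -` A) / snd \<gamma>"
    using assms(1) B by (subst measure_uniform_measure) auto
  finally show "measure (orbit_measure \<phi> orig \<gamma>) A
      = measure lborel ({0..snd \<gamma>} \<inter> param \<phi> orig \<gamma> -` A) / snd \<gamma>" .
qed

lemma (in H_flow) orbit_measure_le_1:
  assumes "snd \<gamma> > 0" "A \<in> sets borel"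
  shows "measure (orbit_measure \<phi> orig \<gamma>) A \<le> 1"
proof -
  have "measure lborel ({0..snd \<gamma>} \<inter> param \<phi> orig \<gamma> -` A) \<le> measure lborel {0..snd \<gamma>}"
    using orbit_measure_eq(1)[OF assms] by (intro measure_mono_fmeasurable) (auto simp: fmeasurable_def emeasure_lborel_Icc_eq)
  then show ?thesis using assms by (simp add: orbit_measure_eq)
qed

text \<open>If \<open>L / T0\<close> is large, the loss of the last piece of length at most \<open>2 T0\<close> is absorbed by
  passing from \<open>\<alpha>'\<close> to \<open>\<alpha>' / 2\<close>.\<close>

lemma (in H_flow) many_visits:
  assumes A: "A \<in> sets borel" and \<mu>: "measure (orbit_measure \<phi> orig \<gamma>) A \<ge> \<alpha>'" and \<alpha>': "\<alpha>' > 0"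
    and L: "L > 0" "L \<le> snd \<gamma>" "snd \<gamma> \<le> L + T0" and T0: "T0 > 0" "4 * T0 < \<alpha>' * L"
  shows "\<exists>s\<in>{0..T0}. real (card {i \<in> {0..<nat \<lfloor>L / T0\<rfloor>}. param \<phi> orig \<gamma> (s + real i * T0) \<in> A})
              \<ge> \<alpha>' / 2 * (L / T0)"
proof -
  have pos: "snd \<gamma> > 0" using L by simp
  note eq = orbit_measure_eq[where orig = orig and \<gamma> = \<gamma>, OF pos A]
  define n where "n = nat \<lfloor>L / T0\<rfloor>"
  have "L / T0 \<ge> 0" using L T0 by simp
  then have "real n \<le> L / T0" "L / T0 \<le> real n + 1" unfolding n_def by linarith+
  then have n: "real n * T0 \<le> L" "L \<le> real n * T0 + T0" using T0(1) by (auto simp: field_simps)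
  have "measure lborel ({0..snd \<gamma>} \<inter> param \<phi> orig \<gamma> -` A) \<ge> \<alpha>' * snd \<gamma>"
    using \<mu> pos unfolding eq(2) by (simp add: field_simps)
  moreover have "\<alpha>' * snd \<gamma> \<ge> \<alpha>' * L" using L \<alpha>' by simp
  ultimately have "(\<alpha>' / 2 * (L / T0)) * T0
      < measure lborel ({0..snd \<gamma>} \<inter> param \<phi> orig \<gamma> -` A) - (snd \<gamma> - real n * T0)"
    using n L T0 by simp
  from sampling[OF eq(1) T0(1) _ this] n L show ?thesis
    by (simp add: n_def)
qed

theorem proposition6p9:
  fixes \<A> :: "('a::metric_space, 'e::euclidean_space) rchart set"
    and \<phi> :: "real \<Rightarrow> 'a \<Rightarrow> 'a"
    and orig :: "'a set \<times> real \<Rightarrow> 'a"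
    and K K0 A :: "'a set"
    and \<sigma> \<alpha> \<alpha>' :: real
  assumes "H_flow \<A> \<phi>"
    and "origin_choice \<phi> orig"
    and "compact K" "interior K \<noteq> {}" "\<sigma> > 0" "h_Gur \<phi> K \<sigma> > 0"
    and "compact K0" "interior K0 \<noteq> {}"
    and "A \<in> sets borel"
    and "0 < \<alpha>'" "\<alpha>' < \<alpha>"
  shows "\<exists>N>0. \<forall>L T0 :: real.
    L > T0 \<and> T0 > 5 * tauK \<phi> K0 \<and> L / T0 \<ge> N \<and> mKL \<phi> orig K0 L A \<ge> \<alpha> \<longrightarrow>
    real (card {\<gamma> \<in> PK_prim \<phi> K0 L (L + 5 * tauK \<phi> K0).
            \<exists>s\<in>{0..T0}.
              real (card {i \<in> {0..<nat \<lfloor>L / T0\<rfloor>}. param \<phi> orig \<gamma> (s + real i * T0) \<in> A})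
              \<ge> \<alpha>' / 2 * (L / T0)})
    \<ge> 0.99 * ((\<alpha> - \<alpha>') / (1 - \<alpha>')) * real (card (PK \<phi> K0 L (L + 5 * tauK \<phi> K0)))"
proof -
  interpret H_flow \<A> \<phi> by fact
  define \<tau> where "\<tau> = tauK \<phi> K0"
  have \<tau>: "\<tau> \<ge> 1" using tauK_attained[OF assms(7,8)] unfolding \<tau>_def by blast
  have "\<exists>C>0. \<exists>L0. \<forall>L\<ge>L0. finite (PK \<phi> K0 L (L + 5 * \<tau>)) \<longrightarrow>
       real (card (PK \<phi> K0 L (L + 5 * \<tau>) - PK_prim \<phi> K0 L (L + 5 * \<tau>))) * L
         \<le> C * real (card (PK \<phi> K0 L (L + 5 * \<tau>)))"
    unfolding \<tau>_def
    by (rule non_primitive_rare[OF assms(7,8,2)]) (rule not_single_closed_orbit[OF _ _ assms(5,6)])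
  then obtain C L0 where C: "C > 0" and rare: "\<forall>L\<ge>L0. finite (PK \<phi> K0 L (L + 5 * \<tau>)) \<longrightarrow>
       real (card (PK \<phi> K0 L (L + 5 * \<tau>) - PK_prim \<phi> K0 L (L + 5 * \<tau>))) * L
         \<le> C * real (card (PK \<phi> K0 L (L + 5 * \<tau>)))"
    by (elim exE conjE)
  define c where "c = (\<alpha> - \<alpha>') / (1 - \<alpha>')"
  define N where "N = max (max 1 L0) (max (5 / \<alpha>') (100 * C / c))"
  show ?thesis
  proof (intro exI[of _ N] conjI allI impI)
    show "N > 0" by (simp add: N_def)
    fix L T0 :: real
    assume "L > T0 \<and> T0 > 5 * tauK \<phi> K0 \<and> L / T0 \<ge> N \<and> mKL \<phi> orig K0 L A \<ge> \<alpha>"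
    then have L: "L > T0" "T0 > 5 * \<tau>" "L / T0 \<ge> N" and m: "mKL \<phi> orig K0 L A \<ge> \<alpha>"
      by (auto simp: \<tau>_def)
    have N: "N \<ge> 1" "N \<ge> L0" "N \<ge> 5 / \<alpha>'" "N \<ge> 100 * C / c" by (auto simp: N_def)
    have T0: "T0 \<ge> 1" using L \<tau> by simp
    have "N * 1 \<le> N * T0" using N(1) T0 by (intro mult_left_mono) auto
    also have "\<dots> \<le> L" using L(3) T0 by (simp add: field_simps)
    finally have LN: "L \<ge> N" by simp
    define P where "P = PK \<phi> K0 L (L + 5 * \<tau>)"
    define \<mu> where "\<mu> \<gamma> = measure (orbit_measure \<phi> orig \<gamma>) A" for \<gamma>
    have P: "L \<le> snd \<gamma>" "snd \<gamma> \<le> L + 5 * \<tau>" "\<mu> \<gamma> \<le> 1" if "\<gamma> \<in> P" for \<gamma>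
    proof -
      show l: "L \<le> snd \<gamma>" "snd \<gamma> \<le> L + 5 * \<tau>" using that by (auto simp: P_def PK_def)
      show "\<mu> \<gamma> \<le> 1" unfolding \<mu>_def
        by (rule orbit_measure_le_1[OF _ assms(9)]) (use l L(1) T0 in simp)
    qed
    have mP: "mKL \<phi> orig K0 L A = 1 / real (card P) * (\<Sum>\<gamma>\<in>P. \<mu> \<gamma>)"
      by (simp add: mKL_def P_def \<tau>_def \<mu>_def)
    \<comment> \<open>For an infinite set of orbits the mean would be 0 by convention.\<close>
    have cP: "card P > 0" using m assms(10,11) unfolding mP by (cases "card P = 0") auto
    then have fin: "finite P" by (simp add: card_ge_0_finite)
    have mean: "\<alpha> * real (card P) \<le> (\<Sum>\<gamma>\<in>P. \<mu> \<gamma>)"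
      using m cP unfolding mP by (simp add: field_simps)
    also have "\<dots> \<le> (\<Sum>\<gamma>\<in>P. 1)" using P(3) by (rule sum_mono)
    finally have "\<alpha> \<le> 1" using cP by simp
    then have \<alpha>1: "1 - \<alpha>' > 0" using assms(11) by simp
    then have c: "c > 0" using assms(11) by (simp add: c_def)
    \<comment> \<open>Markov's inequality for \<open>1 - \<mu>\<close>.\<close>
    define S where "S = {\<gamma> \<in> P. \<mu> \<gamma> \<ge> \<alpha>'}"
    note mean
    also have "(\<Sum>\<gamma>\<in>P. \<mu> \<gamma>) \<le> (\<Sum>\<gamma>\<in>P. \<alpha>' + (1 - \<alpha>') * of_bool (\<gamma> \<in> S))"
      using P(3) by (intro sum_mono) (auto simp: S_def)
    also have "\<dots> = \<alpha>' * real (card P) + (1 - \<alpha>') * real (card S)"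
      using fin by (simp add: sum.distrib S_def Int_def flip: sum_distrib_left)
    finally have S: "c * real (card P) \<le> real (card S)"
      using \<alpha>1 unfolding c_def by (simp add: field_simps)
    define NP where "NP = P - PK_prim \<phi> K0 L (L + 5 * \<tau>)"
    have "100 * C / c \<le> L" using LN N(4) by simp
    then have "100 * C \<le> c * L" using c by (simp add: field_simps)
    then have "100 * (real (card NP) * L) \<le> c * L * real (card P)"
      using rare[rule_format, of L] LN N(2) fin mult_right_mono[of "100 * C" "c * L" "real (card P)"]
      by (simp add: NP_def P_def)
    then have NP: "real (card NP) \<le> 0.01 * c * real (card P)"
      using LN N(1) by (simp add: field_simps)
    define G where "G = {\<gamma> \<in> PK_prim \<phi> K0 L (L + 5 * tauK \<phi> K0).
            \<exists>s\<in>{0..T0}.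
              real (card {i \<in> {0..<nat \<lfloor>L / T0\<rfloor>}. param \<phi> orig \<gamma> (s + real i * T0) \<in> A})
              \<ge> \<alpha>' / 2 * (L / T0)}"
    have G: "finite G" using fin by (rule finite_subset[rotated]) (auto simp: G_def P_def PK_prim_def \<tau>_def)
    have "5 / \<alpha>' \<le> L / T0" using N(3) L(3) by simp
    then have "4 * T0 < \<alpha>' * L" using T0 assms(10) by (simp add: field_simps)
    then have "S - NP \<subseteq> G"
      using many_visits[OF assms(9) _ assms(10), of orig _ L T0] P(1,2) L T0
      by (force simp: S_def NP_def G_def \<mu>_def \<tau>_def)
    then have "card (S - NP) \<le> card G" by (rule card_mono[OF G])
    moreover have "card S - card NP \<le> card (S - NP)"
      by (rule diff_card_le_card_Diff) (use fin in \<open>simp add: NP_def\<close>)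
    ultimately have "real (card S) \<le> real (card NP) + real (card G)" by linarith
    then have "0.99 * c * real (card P) \<le> real (card G)" using S NP by simp
    then show "real (card {\<gamma> \<in> PK_prim \<phi> K0 L (L + 5 * tauK \<phi> K0).
            \<exists>s\<in>{0..T0}.
              real (card {i \<in> {0..<nat \<lfloor>L / T0\<rfloor>}. param \<phi> orig \<gamma> (s + real i * T0) \<in> A})
              \<ge> \<alpha>' / 2 * (L / T0)})
      \<ge> 0.99 * ((\<alpha> - \<alpha>') / (1 - \<alpha>')) * real (card (PK \<phi> K0 L (L + 5 * tauK \<phi> K0)))"
      unfolding G_def c_def P_def \<tau>_def .
  qed
qed

end
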